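(* Let $\mathcal{M}$ be a Bregman manifold, let $\nu_1,\dots,\nu_K$ be compactly supported probability measures on $\mathcal{M}$, absolutely continuous with respect to the Riemannian volume measure on $\mathcal{M}$, and let $\lambda_1,\dots,\lambda_K\ge0$ with $\sum_{i=1}^K\lambda_i=1$. Then there exists a right Bregman-Wasserstein barycenter, i.e. a measure $$\bar\nu_\lambda\in\operatorname*{arg\,min}_{\nu\in\mathcal{P}(\mathcal{M})}\ \sum_{i=1}^K\lambda_i\,\mathscr{B}(\nu_i,\nu).$$
   Context: A regular Bregman generator on an open convex set $\mathcal{X}\subset\mathbb{R}^d$ is a smooth convex function $\Omega:\mathcal{X}\to\mathbb{R}$ with Hessian $D^2\Omega$ positive definite everywhere and with $\mathcal{Y}:=D\Omega(\mathcal{X})$ convex. Then $D\Omega:\mathcal{X}\to\mathcal{Y}$ is a diffeomorphism with inverse $D\Omega^*$, where $\Omega^*(y)=x\cdot y-\Omega(x)$ for $y=D\Omega(x)$. The associated Bregman manifold $\mathcal{M}$ is the smooth manifold with two global charts $\iota:\mathcal{M}\to\mathcal{X}$ and $\iota^*=D\Omega\circ\iota:\mathcal{M}\to\mathcal{Y}$; write $x_p=\iota(p)$, $y_p=\iota^*(p)$. It carries the Riemannian metric with matrix $D^2\Omega(x)$ in the $x$-coordinates. The Bregman divergence is $\mathbf{B}(p,q)=\Omega(x_p)+\Omega^*(y_q)-x_p\cdot y_q=\Omega(x_p)-\Omega(x_q)-D\Omega(x_q)\cdot(x_p-x_q)$. $\mathcal{P}(\mathcal{M})$ denotes the Borel probability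 measures on $\mathcal{M}$, and $\mathscr{B}(\mu,\nu)=\inf_{\pi\in\Pi(\mu,\nu)}\int_{\mathcal{M}\times\mathcal{M}}\mathbf{B}(p,q)\,d\pi(p,q)$, where $\Pi(\mu,\nu)$ is the set of couplings of $\mu$ and $\nu$. *)

theory Defs
  imports "HOL-Probability.Probability"
begin

section \<open>Smooth functions on an open subset of Euclidean space\<close>

definition partial :: "'n \<Rightarrow> (real ^ 'n \<Rightarrow> real) \<Rightarrow> real ^ 'n \<Rightarrow> real" where
  "partial i f x = frechet_derivative f (at x) (axis i 1)"

text \<open>Only meaningful for open \<open>X\<close>: \<open>Ck_on k f X\<close> says that \<open>f\<close> is of class $C^k$ on \<open>X\<close>.\<close>

primrec Ck_on :: "nat \<Rightarrow> (real ^ 'n \<Rightarrow> real) \<Rightarrow> (real ^ 'n) set \<Rightarrow> bool" where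
  "Ck_on 0 f X \<longleftrightarrow> continuous_on X f"
| "Ck_on (Suc k) f X \<longleftrightarrow>
     (\<forall>x\<in>X. f differentiable (at x)) \<and> (\<forall>i. Ck_on k (partial i f) X)"

definition smooth_on :: "(real ^ 'n) set \<Rightarrow> (real ^ 'n \<Rightarrow> real) \<Rightarrow> bool" where
  "smooth_on X f \<longleftrightarrow> (\<forall>k. Ck_on k f X)"

definition grad :: "(real ^ 'n \<Rightarrow> real) \<Rightarrow> real ^ 'n \<Rightarrow> real ^ 'n" where
  "grad f x = (\<chi> i. partial i f x)"

definition hessian :: "(real ^ 'n \<Rightarrow> real) \<Rightarrow> real ^ 'n \<Rightarrow> real ^ 'n ^ 'n" where
  "hessian f x = (\<chi> i j. partial i (partial j f) x)"

definition positive_definite :: "real ^ 'n ^ 'n \<Rightarrow> bool" where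
  "positive_definite A \<longleftrightarrow> transpose A = A \<and> (\<forall>v. v \<noteq> 0 \<longrightarrow> v \<bullet> (A *v v) > 0)"


section \<open>Bregman manifolds\<close>

locale regular_bregman_generator =
  fixes X :: "(real ^ 'n) set" and \<Omega> :: "real ^ 'n \<Rightarrow> real"
  assumes open_X: "open X" and convex_X: "convex X"
    and smooth: "smooth_on X \<Omega>"
    and convex_Omega: "convex_on X \<Omega>"
    and hessian_pos: "\<And>x. x \<in> X \<Longrightarrow> positive_definite (hessian \<Omega> x)"
    and convex_Y: "convex (grad \<Omega> ` X)"

text \<open>
  A manifold with a global chart \<open>\<iota>\<close> is a topological space \<open>M\<close> with a homeomorphism \<open>\<iota>\<close>
  from \<open>M\<close> onto the open set \<open>X\<close>; its smooth structure is the one for which \<open>\<iota>\<close> is a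
  diffeomorphism. The dual chart is determined by \<open>\<iota>\<close> and \<open>\<Omega>\<close>, and is compatible because the
  gradient of \<open>\<Omega>\<close> is a diffeomorphism onto its image.
\<close>

locale bregman_manifold = regular_bregman_generator X \<Omega>
  for X :: "(real ^ 'n) set" and \<Omega> :: "real ^ 'n \<Rightarrow> real" +
  fixes M :: "'m topology" and \<iota> :: "'m \<Rightarrow> real ^ 'n"
  assumes chart: "homeomorphic_map M (top_of_set X) \<iota>"

definition dual_chart :: "(real ^ 'n \<Rightarrow> real) \<Rightarrow> ('m \<Rightarrow> real ^ 'n) \<Rightarrow> 'm \<Rightarrow> real ^ 'n" where
  "dual_chart \<Omega> \<iota> p = grad \<Omega> (\<iota> p)"

definition legendre_conjugate ::
    "(real ^ 'n) set \<Rightarrow> (real ^ 'n \<Rightarrow> real) \<Rightarrow> real ^ 'n \<Rightarrow> real" where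
  "legendre_conjugate X \<Omega> y = (let x = inv_into X (grad \<Omega>) y in x \<bullet> y - \<Omega> x)"

definition bregman_divergence ::
    "(real ^ 'n) set \<Rightarrow> (real ^ 'n \<Rightarrow> real) \<Rightarrow> ('m \<Rightarrow> real ^ 'n) \<Rightarrow> 'm \<Rightarrow> 'm \<Rightarrow> real" where
  "bregman_divergence X \<Omega> \<iota> p q =
     \<Omega> (\<iota> p) + legendre_conjugate X \<Omega> (dual_chart \<Omega> \<iota> q) - \<iota> p \<bullet> dual_chart \<Omega> \<iota> q"

definition borel_of :: "'m topology \<Rightarrow> 'm measure" where
  "borel_of M = sigma (topspace M) {U. openin M U}"

text \<open>
  The metric has matrix \<open>hessian \<Omega> x\<close> in the chart \<open>\<iota>\<close>, so its volume measure has density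
  \<open>sqrt (det (hessian \<Omega> x))\<close> with respect to Lebesgue measure in this chart.
\<close>

definition riemannian_volume ::
    "(real ^ 'n) set \<Rightarrow> (real ^ 'n \<Rightarrow> real) \<Rightarrow> 'm topology \<Rightarrow> ('m \<Rightarrow> real ^ 'n) \<Rightarrow> 'm measure" where
  "riemannian_volume X \<Omega> M \<iota> =
     distr (density (restrict_space lborel X) (\<lambda>x. ennreal (sqrt (det (hessian \<Omega> x)))))
       (borel_of M) (inv_into (topspace M) \<iota>)"


section \<open>Probability measures, couplings and the Bregman-Wasserstein divergence\<close>

definition borel_prob :: "'m topology \<Rightarrow> 'm measure set" where
  "borel_prob M = {\<mu>. prob_space \<mu> \<and> sets \<mu> = sets (borel_of M)}"

definition measure_support :: "'m topology \<Rightarrow> 'm measure \<Rightarrow> 'm set" where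
  "measure_support M \<mu> = {p \<in> topspace M. \<forall>U. openin M U \<and> p \<in> U \<longrightarrow> emeasure \<mu> U > 0}"

definition compactly_supported :: "'m topology \<Rightarrow> 'm measure \<Rightarrow> bool" where
  "compactly_supported M \<mu> \<longleftrightarrow> compactin M (measure_support M \<mu>)"

text \<open>
  A Bregman manifold is second countable, so the product \<open>\<sigma>\<close>-algebra used here is the Borel
  \<open>\<sigma>\<close>-algebra of the product topology.
\<close>

definition couplings :: "'m topology \<Rightarrow> 'm measure \<Rightarrow> 'm measure \<Rightarrow> ('m \<times> 'm) measure set" where
  "couplings M \<mu> \<nu> =
     {\<pi>. prob_space \<pi> \<and> sets \<pi> = sets (borel_of M \<Otimes>\<^sub>M borel_of M)
        \<and> distr \<pi> (borel_of M) fst = \<mu> \<and> distr \<pi> (borel_of M) snd = \<nu>}"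

text \<open>
  The coercion \<open>ennreal\<close> loses nothing, since the divergence is nonnegative
  (lemma \<open>bregman_divergence_nonneg\<close> below).
\<close>

definition bregman_wasserstein ::
    "(real ^ 'n) set \<Rightarrow> (real ^ 'n \<Rightarrow> real) \<Rightarrow> 'm topology \<Rightarrow> ('m \<Rightarrow> real ^ 'n)
      \<Rightarrow> 'm measure \<Rightarrow> 'm measure \<Rightarrow> ennreal" where
  "bregman_wasserstein X \<Omega> M \<iota> \<mu> \<nu> =
     (INF \<pi>\<in>couplings M \<mu> \<nu>.
        \<integral>\<^sup>+ z. ennreal (bregman_divergence X \<Omega> \<iota> (fst z) (snd z)) \<partial>\<pi>)"

definition right_barycenter ::
    "(real ^ 'n) set \<Rightarrow> (real ^ 'n \<Rightarrow> real) \<Rightarrow> 'm topology \<Rightarrow> ('m \<Rightarrow> real ^ 'n)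
      \<Rightarrow> nat \<Rightarrow> (nat \<Rightarrow> real) \<Rightarrow> (nat \<Rightarrow> 'm measure) \<Rightarrow> 'm measure \<Rightarrow> bool" where
  "right_barycenter X \<Omega> M \<iota> K lam \<nu> \<nu>bar \<longleftrightarrow>
     is_arg_min (\<lambda>\<rho>. \<Sum>i=1..K. ennreal (lam i) * bregman_wasserstein X \<Omega> M \<iota> (\<nu> i) \<rho>)
       (\<lambda>\<rho>. \<rho> \<in> borel_prob M) \<nu>bar"


section \<open>Sanity checks on the divergence and the volume measure\<close>

context regular_bregman_generator
begin

lemma Omega_derivative:
  assumes "x \<in> X"
  shows "(\<Omega> has_derivative (\<lambda>v. grad \<Omega> x \<bullet> v)) (at x)"
proof -
  have "Ck_on (Suc 0) \<Omega> X" using smooth unfolding smooth_on_def by blast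
  hence d: "(\<Omega> has_derivative frechet_derivative \<Omega> (at x)) (at x)"
    using assms frechet_derivative_works by auto
  interpret l: bounded_linear "frechet_derivative \<Omega> (at x)" using d by (rule has_derivative_bounded_linear)
  have "frechet_derivative \<Omega> (at x) v = grad \<Omega> x \<bullet> v" for v
  proof -
    have "frechet_derivative \<Omega> (at x) v = frechet_derivative \<Omega> (at x) (\<Sum>i\<in>UNIV. v $ i *\<^sub>R axis i 1)"
      by (simp add: basis_expansion flip: scalar_mult_eq_scaleR)
    also have "\<dots> = grad \<Omega> x \<bullet> v"
      by (simp add: l.sum l.scaleR grad_def partial_def inner_vec_def mult.commute)
    finally show ?thesis .
  qed
  thus ?thesis using d by presburger
qed

lemma partial_derivative:
  assumes "x \<in> X"
  shows "(partial j \<Omega> has_derivative (\<lambda>v. \<Sum>i\<in>UNIV. v $ i * hessian \<Omega> x $ i $ j)) (at x)"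
proof -
  have "Ck_on (Suc (Suc 0)) \<Omega> X" using smooth unfolding smooth_on_def by blast
  hence d: "(partial j \<Omega> has_derivative frechet_derivative (partial j \<Omega>) (at x)) (at x)"
    using assms by (simp flip: frechet_derivative_works)
  interpret l: bounded_linear "frechet_derivative (partial j \<Omega>) (at x)"
    using d by (rule has_derivative_bounded_linear)
  have "frechet_derivative (partial j \<Omega>) (at x) v = (\<Sum>i\<in>UNIV. v $ i * hessian \<Omega> x $ i $ j)" for v
  proof -
    have "frechet_derivative (partial j \<Omega>) (at x) v
        = frechet_derivative (partial j \<Omega>) (at x) (\<Sum>i\<in>UNIV. v $ i *\<^sub>R axis i 1)"
      by (simp add: basis_expansion flip: scalar_mult_eq_scaleR)
    also have "\<dots> = (\<Sum>i\<in>UNIV. v $ i * hessian \<Omega> x $ i $ j)"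
      by (simp add: l.sum l.scaleR hessian_def partial_def)
    finally show ?thesis .
  qed
  thus ?thesis using d by presburger
qed

lemma segment_in_X:
  assumes "x \<in> X" "z \<in> X" "0 \<le> t" "t \<le> 1"
  shows "z + t *\<^sub>R (x - z) \<in> X"
proof -
  have "(1 - t) *\<^sub>R z + t *\<^sub>R x \<in> X" using assms convex_X by (simp add: convex_alt)
  thus ?thesis by (simp add: algebra_simps)
qed

lemma grad_increasing:
  assumes "x \<in> X" "z \<in> X" "x \<noteq> z" "0 \<le> s" "s < t" "t \<le> 1"
  shows "grad \<Omega> (z + s *\<^sub>R (x - z)) \<bullet> (x - z) < grad \<Omega> (z + t *\<^sub>R (x - z)) \<bullet> (x - z)"
proof (rule DERIV_pos_imp_increasing[OF \<open>s < t\<close>])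
  fix r assume r: "s \<le> r" "r \<le> t"
  define v where "v = x - z"
  define y where "y = z + r *\<^sub>R v"
  have y: "y \<in> X" unfolding y_def v_def using r assms by (intro segment_in_X) auto
  have l: "((\<lambda>r. z + r *\<^sub>R v) has_derivative (\<lambda>h. h *\<^sub>R v)) (at r)"
    by (auto intro!: derivative_eq_intros)
  have "((\<lambda>r. partial j \<Omega> (z + r *\<^sub>R v)) has_derivative
      (\<lambda>h. \<Sum>i\<in>UNIV. (h *\<^sub>R v) $ i * hessian \<Omega> y $ i $ j)) (at r)" for j
    using diff_chain_at[OF l partial_derivative[OF y, unfolded y_def]] by (simp add: o_def y_def)
  hence "((\<lambda>r. \<Sum>j\<in>UNIV. partial j \<Omega> (z + r *\<^sub>R v) * v $ j) has_derivative
      (\<lambda>h. \<Sum>j\<in>UNIV. (\<Sum>i\<in>UNIV. (h *\<^sub>R v) $ i * hessian \<Omega> y $ i $ j) * v $ j)) (at r)"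
    by (intro has_derivative_sum has_derivative_mult_left)
  moreover have "(\<lambda>h. \<Sum>j\<in>UNIV. (\<Sum>i\<in>UNIV. (h *\<^sub>R v) $ i * hessian \<Omega> y $ i $ j) * v $ j)
      = (*) (v \<bullet> (hessian \<Omega> y *v v))"
  proof
    fix h
    have "v \<bullet> (hessian \<Omega> y *v v) = (\<Sum>i\<in>UNIV. \<Sum>j\<in>UNIV. v $ i * hessian \<Omega> y $ i $ j * v $ j)"
      by (simp add: inner_vec_def matrix_vector_mult_def sum_distrib_left mult.assoc)
    also have "\<dots> = (\<Sum>j\<in>UNIV. \<Sum>i\<in>UNIV. v $ i * hessian \<Omega> y $ i $ j * v $ j)"
      by (rule sum.swap)
    finally show "(\<Sum>j\<in>UNIV. (\<Sum>i\<in>UNIV. (h *\<^sub>R v) $ i * hessian \<Omega> y $ i $ j) * v $ j)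
        = v \<bullet> (hessian \<Omega> y *v v) * h"
      by (simp add: sum_distrib_left sum_distrib_right algebra_simps)
  qed
  ultimately have "((\<lambda>r. grad \<Omega> (z + r *\<^sub>R v) \<bullet> v) has_real_derivative v \<bullet> (hessian \<Omega> y *v v)) (at r)"
    by (simp add: has_field_derivative_def grad_def inner_vec_def)
  moreover have "v \<bullet> (hessian \<Omega> y *v v) > 0"
    using hessian_pos[OF y] assms unfolding positive_definite_def v_def by auto
  ultimately show "\<exists>D. ((\<lambda>r. grad \<Omega> (z + r *\<^sub>R (x - z)) \<bullet> (x - z)) has_real_derivative D) (at r) \<and> 0 < D"
    unfolding v_def by blast
qed

lemma inj_on_grad: "inj_on (grad \<Omega>) X"
proof (rule inj_onI, rule ccontr)
  fix x z assume "x \<in> X" "z \<in> X" "grad \<Omega> x = grad \<Omega> z" "x \<noteq> z"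
  thus False using grad_increasing[of x z 0 1] by simp
qed

lemma Omega_above_tangent:
  assumes "x \<in> X" "z \<in> X"
  shows "\<Omega> z + grad \<Omega> z \<bullet> (x - z) \<le> \<Omega> x"
proof (cases "x = z")
  case False
  have d: "((\<lambda>t. \<Omega> (z + t *\<^sub>R (x - z))) has_real_derivative grad \<Omega> (z + t *\<^sub>R (x - z)) \<bullet> (x - z)) (at t)"
    if "0 \<le> t" "t \<le> 1" for t
  proof -
    have l: "((\<lambda>t. z + t *\<^sub>R (x - z)) has_derivative (\<lambda>h. h *\<^sub>R (x - z))) (at t)"
      by (auto intro!: derivative_eq_intros)
    show ?thesis
      using diff_chain_at[OF l Omega_derivative[OF segment_in_X[OF assms that]]]
      by (simp add: o_def has_field_derivative_def mult_commute_abs)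
  qed
  obtain t where "0 < t" "t < 1"
    "\<Omega> (z + 1 *\<^sub>R (x - z)) - \<Omega> (z + 0 *\<^sub>R (x - z)) = (1 - 0) * (grad \<Omega> (z + t *\<^sub>R (x - z)) \<bullet> (x - z))"
    using MVT2[OF zero_less_one d] by blast
  thus ?thesis using grad_increasing[OF assms False, of 0 t] by simp
qed simp

end

context bregman_manifold
begin

lemma chart_in_X: "p \<in> topspace M \<Longrightarrow> \<iota> p \<in> X"
  using chart homeomorphic_imp_surjective_map by fastforce

lemma bregman_divergence_eq:
  assumes "q \<in> topspace M"
  shows "bregman_divergence X \<Omega> \<iota> p q = \<Omega> (\<iota> p) - \<Omega> (\<iota> q) - grad \<Omega> (\<iota> q) \<bullet> (\<iota> p - \<iota> q)"
  using chart_in_X[OF assms] inj_on_grad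
  by (simp add: bregman_divergence_def legendre_conjugate_def dual_chart_def Let_def
      inner_diff_right inner_commute)

lemma bregman_divergence_nonneg:
  assumes "p \<in> topspace M" "q \<in> topspace M"
  shows "bregman_divergence X \<Omega> \<iota> p q \<ge> 0"
  using Omega_above_tangent[OF chart_in_X[OF assms(1)] chart_in_X[OF assms(2)]]
  by (simp add: bregman_divergence_eq[OF assms(2)])

lemma emeasure_riemannian_volume:
  assumes "A \<in> sets (borel_of M)"
  shows "emeasure (riemannian_volume X \<Omega> M \<iota>) A
    = (\<integral>\<^sup>+ x. ennreal (sqrt (det (hessian \<Omega> x))) * indicator (\<iota> ` A) x \<partial>lborel)"
proof -
  have sp: "space (borel_of M) = topspace M" "sets (borel_of M) = sigma_sets (topspace M) {U. openin M U}"
    unfolding borel_of_def by (simp_all add: openin_subset Pow_def Collect_mono)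
  have bij: "bij_betw \<iota> (topspace M) X"
    using homeomorphic_imp_injective_map[OF chart] homeomorphic_imp_surjective_map[OF chart]
    by (simp add: bij_betw_def)
  have preim: "inv_into (topspace M) \<iota> -` B \<inter> X = \<iota> ` B" if "B \<subseteq> topspace M" for B
    using that bij by (force simp: bij_betw_def inv_into_f_f image_iff)
  have meas: "inv_into (topspace M) \<iota> \<in> measurable (restrict_space lborel X) (borel_of M)"
    unfolding borel_of_def
  proof (rule measurable_measure_of)
    show "inv_into (topspace M) \<iota> \<in> space (restrict_space lborel X) \<rightarrow> topspace M"
      using bij by (auto simp: space_restrict_space bij_betw_def inv_into_into)
    fix U assume "U \<in> {U. openin M U}"
    hence U: "openin M U" by simp
    hence "openin (top_of_set X) (\<iota> ` U)"
      using chart by (meson homeomorphic_imp_open_map open_map_def)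
    hence "open (\<iota> ` U)" "\<iota> ` U \<subseteq> X" using openin_open_eq[OF open_X] by simp_all
    thus "inv_into (topspace M) \<iota> -` U \<inter> space (restrict_space lborel X) \<in> sets (restrict_space lborel X)"
      using preim[OF openin_subset[OF U]] open_X
      by (auto simp: space_restrict_space sets_restrict_space_iff)
  qed (auto dest: openin_subset)
  have "Ck_on (Suc (Suc 0)) \<Omega> X" using smooth unfolding smooth_on_def by blast
  hence "continuous_on X (partial i (partial j \<Omega>))" for i j by auto
  hence "continuous_on X (hessian \<Omega>)" unfolding hessian_def
    by (intro continuous_on_vec_lambda)
  hence "continuous_on X (\<lambda>x. sqrt (det (hessian \<Omega> x)))"
    by (auto simp: det_def intro!: continuous_intros)
  hence dens: "(\<lambda>x. ennreal (sqrt (det (hessian \<Omega> x)))) \<in> borel_measurable (restrict_space lborel X)"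
    using borel_measurable_continuous_on_restrict[of X "\<lambda>x. sqrt (det (hessian \<Omega> x))"]
    by (simp add: measurable_cong_sets[OF sets_restrict_space_cong[OF sets_lborel] refl])
  have A: "A \<subseteq> topspace M" using sets.sets_into_space[OF assms] sp by simp
  have Ain: "\<iota> ` A \<in> sets (restrict_space lborel X)"
    using measurable_sets[OF meas assms] preim[OF A] by (simp add: space_restrict_space)
  have AX: "\<iota> ` A \<subseteq> X" using A bij by (auto simp: bij_betw_def)
  have "emeasure (riemannian_volume X \<Omega> M \<iota>) A
      = emeasure (density (restrict_space lborel X) (\<lambda>x. ennreal (sqrt (det (hessian \<Omega> x))))) (\<iota> ` A)"
    unfolding riemannian_volume_def using meas assms preim[OF A]
    by (subst emeasure_distr) (auto simp: space_restrict_space)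
  also have "\<dots> = (\<integral>\<^sup>+ x. ennreal (sqrt (det (hessian \<Omega> x))) * indicator (\<iota> ` A) x \<partial>restrict_space lborel X)"
    using dens Ain by (rule emeasure_density)
  also have "\<dots> = (\<integral>\<^sup>+ x. ennreal (sqrt (det (hessian \<Omega> x))) * indicator (\<iota> ` A) x * indicator X x \<partial>lborel)"
    using open_X by (intro nn_integral_restrict_space) auto
  also have "\<dots> = (\<integral>\<^sup>+ x. ennreal (sqrt (det (hessian \<Omega> x))) * indicator (\<iota> ` A) x \<partial>lborel)"
    using AX by (intro nn_integral_cong) (auto simp: indicator_def)
  finally show ?thesis .
qed

end

end

theory Submission
  imports Defs
begin

text \<open>
  The idea is that a competitor can be replaced by a better one that lives on a fixed compact set.
  Let \<open>C\<close> be the convex hull, in the chart \<open>\<iota>\<close>, of the supports of all \<open>\<nu> i\<close>. It is a compact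
  subset of the convex set \<open>X\<close>. Given a probability measure \<open>\<rho>\<close> and couplings \<open>\<pi> i\<close> of \<open>\<nu> i\<close> and
  \<open>\<rho>\<close>, let \<open>T z\<close> be the \<open>lam\<close>-weighted average of the conditional means of \<open>x\<close> given \<open>z\<close> under
  \<open>\<pi> i\<close>. Then \<open>T\<close> takes values in \<open>C\<close> (lemma \<open>barycentric_projection\<close>). Writing \<open>B\<close> for the
  divergence, the identity

    \<open>B(x, z) = B(x, T z) + B(T z, z) + (grad \<Omega> (T z) - grad \<Omega> z) \<bullet> (x - T z)\<close>

  shows that moving the second coordinate from \<open>z\<close> to \<open>T z\<close> does not increase the total cost: the
  middle term is nonnegative, and the last one averages to zero because its first factor depends
  only on \<open>z\<close> (lemma \<open>cost_barycentric_projection\<close>). The projection treats all couplings at once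
  through their common second marginal, so that they never have to be glued to a single measure on
  a larger product.

  Applied to a minimizing sequence of measures and couplings, this yields couplings on \<open>C \<times> C\<close>,
  where the cost is continuous. Weak compactness provides a limit, whose couplings have the same
  first marginals, a common second marginal and a total cost equal to the infimum (lemma
  \<open>couplings_compact_subsequence\<close>). This second marginal, carried back to the manifold, is a
  barycenter.

  Weak compactness for measures on a compact set in Euclidean space is reduced to Helly's selection
  theorem on the real line by a space-filling curve and a Borel section of it (lemma
  \<open>prob_measure_compact_subsequence\<close>).
\<close>

section \<open>A space-filling curve with a Borel section\<close>

text \<open>
  A continuous even function of period \<open>2\<close> that is \<open>0\<close> on \<open>[0, 1/3]\<close> and \<open>1\<close> on \<open>[2/3, 1]\<close>, as in
  Schoenberg's construction of a space-filling curve.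
\<close>

definition trit :: "real \<Rightarrow> real" where
  "trit t = max 0 (min 1 (1/2 - cos (pi * t)))"

lemma trit_range: "0 \<le> trit t" "trit t \<le> 1"
  by (simp_all add: trit_def)

lemma continuous_trit: "continuous_on UNIV trit"
  unfolding trit_def by (intro continuous_intros)

text \<open>
  Multiplication by \<open>3 ^ m\<close> moves the first \<open>m\<close> ternary digits, which are all even, into an even
  integer, and periodicity removes it. What remains starts with the digit \<open>2 * a m\<close>, so it lies in
  \<open>[0, 1/3]\<close> or in \<open>[2/3, 1]\<close>. Thus \<^const>\<open>trit\<close> reads off any prescribed sequence of bits
  continuously.
\<close>

lemma trit_ternary_expansion:
  fixes a :: "nat \<Rightarrow> nat"
  assumes a: "\<And>k. a k \<le> 1"
  defines "t \<equiv> (\<Sum>k. 2 * real (a k) / 3 ^ Suc k)"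
  shows "t \<in> {0..1}" "trit (3 ^ m * t) = real (a m)"
proof -
  define u where "u = (\<lambda>m k. 2 * real (a (m + k)) / 3 ^ Suc k)"
  define r where "r = (\<lambda>m. \<Sum>k. u m k)"
  have g: "(\<lambda>k. 2 / 3 ^ Suc k :: real) sums 1"
    using sums_mult[OF geometric_sums[of "1/3::real"], of "2/3"] by (simp add: power_one_over field_simps)
  have bnd: "0 \<le> u m k" "u m k \<le> 2 / 3 ^ Suc k" for m k
    using a[of "m + k"] by (auto simp: u_def divide_right_mono)
  have su: "summable (u m)" for m
    by (rule summable_comparison_test'[OF sums_summable[OF g]]) (use bnd in auto)
  have r01: "0 \<le> r m" "r m \<le> 1" for m
    using suminf_nonneg[OF su bnd(1)] suminf_le[OF bnd(2) su sums_summable[OF g]] sums_unique[OF g]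
    by (simp_all add: r_def)
  have step: "3 * r m = 2 * real (a m) + r (Suc m)" for m
  proof -
    have "r m = u m 0 + (\<Sum>k. u m (Suc k))"
      unfolding r_def using suminf_split_head[OF su[of m]] by simp
    also have "(\<Sum>k. u m (Suc k)) = (\<Sum>k. (1/3) * u (Suc m) k)"
      by (simp add: u_def)
    also have "\<dots> = (1/3) * r (Suc m)" unfolding r_def by (rule suminf_mult[OF su])
    finally show ?thesis by (simp add: u_def)
  qed
  have t: "t = r 0" by (simp add: t_def r_def u_def)
  show "t \<in> {0..1}" using r01 t by simp
  have "\<exists>q::nat. 3 ^ m * t = 2 * real q + r m" for m
  proof (induction m)
    case 0 show ?case by (rule exI[of _ 0]) (simp add: t)
  next
    case (Suc m)
    then obtain q :: nat where "3 ^ m * t = 2 * real q + r m" by blast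
    hence "3 ^ Suc m * t = 2 * real (3 * q + a m) + r (Suc m)" using step[of m] by simp
    thus ?case by blast
  qed
  then obtain q :: nat where "3 ^ m * t = 2 * real q + r m" by blast
  hence "cos (pi * (3 ^ m * t)) = cos (2 * pi * real q + pi * r m)" by (simp add: algebra_simps)
  also have "\<dots> = cos (pi * r m)"
    using sin_int_2pin[of "int q"] cos_int_2pin[of "int q"] by (simp add: cos_add)
  finally have c: "cos (pi * (3 ^ m * t)) = cos (pi * r m)" .
  have "a m = 0 \<or> a m = 1" using a[of m] by linarith
  thus "trit (3 ^ m * t) = real (a m)"
  proof
    assume a0: "a m = 0"
    hence "pi * r m \<le> pi / 3" "0 \<le> pi * r m" using step[of m] r01[of m] r01[of "Suc m"] by auto
    hence "cos (pi / 3) \<le> cos (pi * r m)" by (intro cos_monotone_0_pi_le) auto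
    thus ?thesis using a0 by (simp add: trit_def c cos_60)
  next
    assume a1: "a m = 1"
    hence "pi - pi * r m \<le> pi / 3" "0 \<le> pi - pi * r m"
      using step[of m] r01[of m] r01[of "Suc m"] by (auto simp: algebra_simps)
    hence "cos (pi / 3) \<le> cos (pi - pi * r m)" by (intro cos_monotone_0_pi_le) auto
    thus ?thesis using a1 by (simp add: trit_def c cos_60)
  qed
qed

lemma binary_expansion:
  fixes x :: real
  assumes "0 \<le> x" "x < 1"
  obtains a :: "nat \<Rightarrow> nat" where "\<And>k. a k \<le> 1" "(\<lambda>k. (1/2) ^ Suc k * real (a k)) sums x"
proof
  define d where "d = (\<lambda>k. \<lfloor>2 ^ k * x\<rfloor>)"
  have d: "d (Suc k) - 2 * d k \<in> {0, 1}" for k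
    unfolding d_def by simp linarith
  show "nat (d (Suc k) - 2 * d k) \<le> 1" for k using d[of k] by auto
  define s where "s = (\<lambda>k. of_int (d k) / 2 ^ k :: real)"
  have lim: "s \<longlonglongrightarrow> x"
  proof (rule tendsto_sandwich)
    show "\<forall>\<^sub>F k in sequentially. x - (1/2) ^ k \<le> s k"
    proof (intro always_eventually allI)
      fix k show "x - (1/2) ^ k \<le> s k"
        using divide_right_mono[OF real_of_int_floor_add_one_ge[of "2 ^ k * x"], of "2 ^ k"]
        by (simp add: s_def d_def add_divide_distrib power_one_over)
    qed
    show "\<forall>\<^sub>F k in sequentially. s k \<le> x"
    proof (intro always_eventually allI)
      fix k show "s k \<le> x" using of_int_floor_le[of "2 ^ k * x"]
        by (simp add: s_def d_def field_simps)
    qed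
    have "(\<lambda>k. x - (1/2) ^ k) \<longlonglongrightarrow> x - 0" by (intro tendsto_intros) auto
    thus "(\<lambda>k. x - (1/2) ^ k) \<longlonglongrightarrow> x" by simp
  qed auto
  have "s 0 = 0" using assms by (simp add: s_def d_def floor_eq_iff)
  hence "(\<lambda>k. s (Suc k) - s k) sums x" using telescope_sums[OF lim] by simp
  moreover have "s (Suc k) - s k = (1/2) ^ Suc k * real (nat (d (Suc k) - 2 * d k))" for k
  proof -
    have "real (nat (d (Suc k) - 2 * d k)) = of_int (d (Suc k) - 2 * d k)" using d[of k] by auto
    thus ?thesis by (simp add: s_def field_simps)
  qed
  ultimately show "(\<lambda>k. (1/2) ^ Suc k * real (nat (d (Suc k) - 2 * d k))) sums x" by simp
qed

text \<open>
  Each coordinate of the curve is a binary expansion whose bits are read from \<open>t\<close> by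
  \<^const>\<open>trit\<close>; pairing of naturals reserves infinitely many ternary places of \<open>t\<close> for each
  coordinate, so that all coordinates can be prescribed independently.
\<close>

lemma space_filling_curve:
  fixes S :: "'a :: euclidean_space set"
  assumes "bounded S"
  obtains f :: "real \<Rightarrow> 'a" where "continuous_on UNIV f" "S \<subseteq> f ` {0..1}"
proof -
  obtain R where R: "R > 0" "\<And>x. x \<in> S \<Longrightarrow> norm x < R"
    using bounded_normE_less[OF assms] by metis
  obtain e :: "'a \<Rightarrow> nat" where e: "inj_on e Basis"
    using finite_imp_inj_to_nat_seg[OF finite_Basis] by metis
  define s where "s = (\<lambda>j t. \<Sum>k. (1/2) ^ Suc k * trit (3 ^ prod_encode (j, k) * t))"
  have contp: "continuous_on UNIV (\<lambda>t. trit (c * t))" for c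
    using continuous_on_compose2[OF continuous_trit, of UNIV "\<lambda>t. c * t"]
    by (auto intro: continuous_intros)
  have half: "summable (\<lambda>k. (1/2) ^ Suc k :: real)"
    by (intro summable_mult2 summable_geometric | simp)+
  have cs: "continuous_on UNIV (s j)" for j
  proof -
    have ul: "uniform_limit UNIV (\<lambda>n t. \<Sum>k<n. (1/2) ^ Suc k * trit (3 ^ prod_encode (j, k) * t)) (s j) sequentially"
      unfolding s_def
    proof (rule Weierstrass_m_test)
      fix n and t :: real
      have "(1/2) ^ Suc n * trit (3 ^ prod_encode (j, n) * t) \<le> (1/2) ^ Suc n * 1"
        by (intro mult_left_mono trit_range) auto
      thus "norm ((1/2) ^ Suc n * trit (3 ^ prod_encode (j, n) * t)) \<le> (1/2) ^ Suc n"
        using trit_range(1)[of "3 ^ prod_encode (j, n) * t"] by (simp add: abs_mult)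
    qed (rule half)
    show ?thesis
      by (rule uniform_limit_theorem[OF _ ul])
        (auto intro!: always_eventually continuous_on_sum continuous_on_mult contp
          simp del: power_Suc)
  qed
  define f where "f = (\<lambda>t. \<Sum>b\<in>Basis. (2 * R * s (e b) t - R) *\<^sub>R b)"
  have cf: "continuous_on UNIV f" unfolding f_def
    by (intro continuous_intros cs[unfolded s_def] continuous_on_compose2[OF cs]) auto
  have "x \<in> f ` {0..1}" if x: "x \<in> S" for x
  proof -
    define y where "y = (\<lambda>b. (x \<bullet> b + R) / (2 * R))"
    have y: "0 \<le> y b" "y b < 1" if "b \<in> Basis" for b
      using Basis_le_norm[OF that, of x] R(2)[OF x] R(1) by (auto simp: y_def field_simps)
    have "\<forall>b\<in>Basis. \<exists>a::nat\<Rightarrow>nat. (\<forall>k. a k \<le> 1) \<and> (\<lambda>k. (1/2) ^ Suc k * real (a k)) sums y b"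
      using binary_expansion[OF y] by metis
    then obtain A :: "'a \<Rightarrow> nat \<Rightarrow> nat" where A: "\<And>b k. b \<in> Basis \<Longrightarrow> A b k \<le> 1"
      "\<And>b. b \<in> Basis \<Longrightarrow> (\<lambda>k. (1/2) ^ Suc k * real (A b k)) sums y b"
      by metis
    define a where "a = (\<lambda>m. case prod_decode m of (j, k) \<Rightarrow>
      if j \<in> e ` Basis then A (inv_into Basis e j) k else 0)"
    have a1: "a m \<le> 1" for m
      using A(1) by (auto simp: a_def inv_into_into split: prod.split)
    define t where "t = (\<Sum>k. 2 * real (a k) / 3 ^ Suc k)"
    have t: "t \<in> {0..1}" "\<And>m. trit (3 ^ m * t) = real (a m)"
      unfolding t_def by (rule trit_ternary_expansion[OF a1])+
    have "s (e b) t = y b" if b: "b \<in> Basis" for b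
      using sums_unique[OF A(2)[OF b]] b e by (simp add: s_def t(2) a_def)
    hence "f t = (\<Sum>b\<in>Basis. (x \<bullet> b) *\<^sub>R b)"
      unfolding f_def using R(1) by (intro sum.cong) (auto simp: y_def)
    thus ?thesis using t(1) by (auto simp: euclidean_representation intro!: image_eqI[of _ _ t])
  qed
  thus ?thesis using cf that by blast
qed

text \<open>
  The smallest parameter at which the curve visits \<open>x\<close> is lower semicontinuous in \<open>x\<close>: its
  sublevel sets are images of compact intervals.
\<close>

lemma borel_section:
  fixes f :: "real \<Rightarrow> 'a :: euclidean_space"
  assumes f: "continuous_on UNIV f" and S: "compact S" "S \<subseteq> f ` {0..1}"
  obtains g where "g \<in> borel_measurable borel" "\<And>x. g x \<in> {0..1}" "\<And>x. x \<in> S \<Longrightarrow> f (g x) = x"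
proof -
  define F where "F = (\<lambda>x. {0..1} \<inter> f -` {x})"
  define g where "g = (\<lambda>x. if x \<in> S then Inf (F x) else 0)"
  have clF: "closed (F x)" for x
    unfolding F_def using f by (intro closed_Int closed_vimage) (auto simp: continuous_on_eq_continuous_at)
  have bb: "bdd_below (F x)" for x by (auto simp: F_def intro!: bdd_belowI[of _ 0])
  have InfF: "Inf (F x) \<in> F x" if "x \<in> S" for x
    using that S(2) by (intro closed_contains_Inf clF bb) (auto simp: F_def)
  have le: "Inf (F x) \<le> a \<longleftrightarrow> x \<in> f ` {0..min a 1}" if "x \<in> S" for x a
  proof
    assume "Inf (F x) \<le> a"
    thus "x \<in> f ` {0..min a 1}" using InfF[OF that] by (auto simp: F_def intro!: image_eqI[of _ _ "Inf (F x)"])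
  next
    assume "x \<in> f ` {0..min a 1}"
    then obtain t where "t \<in> F x" "t \<le> a" by (auto simp: F_def)
    thus "Inf (F x) \<le> a" using cInf_lower[OF _ bb, of t x] by linarith
  qed
  have "g \<in> borel_measurable borel"
    unfolding borel_measurable_iff_le
  proof (safe)
    fix a :: real
    have "closed (f ` {0..min a 1})"
      by (intro compact_imp_closed compact_continuous_image continuous_on_subset[OF f]) auto
    moreover have "{x \<in> space borel. g x \<le> a} =
        (S \<inter> f ` {0..min a 1}) \<union> (if 0 \<le> a then - S else {})"
      using le by (auto simp: g_def split: if_splits)
    ultimately show "{x \<in> space borel. g x \<le> a} \<in> sets borel"
      using compact_imp_closed[OF S(1)] by (auto intro!: sets.Un sets.Int borel_closed borel_open)
  qed
  moreover have "g x \<in> {0..1}" for x using InfF by (auto simp: g_def F_def)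
  moreover have "f (g x) = x" if "x \<in> S" for x using InfF[OF that] that by (auto simp: g_def F_def)
  ultimately show ?thesis using that by blast
qed

section \<open>Weak limits of probability measures and couplings\<close>

text \<open>
  Sequential weak compactness in several dimensions follows from Helly's selection theorem on the
  line: a Borel section carries the measures to the interval \<open>[0, 1]\<close>, where a subsequence
  converges, and the space-filling curve, being continuous, carries the limit back. The limit
  gives full mass to \<open>S\<close> because the truncated distance to \<open>S\<close> integrates to \<open>0\<close>.
\<close>

lemma prob_measure_compact_subsequence:
  fixes \<mu> :: "nat \<Rightarrow> 'a :: euclidean_space measure"
  assumes S: "compact S"
    and prob: "\<And>n. prob_space (\<mu> n)" and sets: "\<And>n. sets (\<mu> n) = sets borel"
    and supp: "\<And>n. AE x in \<mu> n. x \<in> S"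
  obtains r \<mu>' where "strict_mono r" "prob_space \<mu>'" "sets \<mu>' = sets borel" "AE x in \<mu>'. x \<in> S"
    "\<And>h :: 'a \<Rightarrow> real. \<lbrakk>continuous_on UNIV h; bounded (range h)\<rbrakk>
       \<Longrightarrow> (\<lambda>n. integral\<^sup>L (\<mu> (r n)) h) \<longlonglongrightarrow> integral\<^sup>L \<mu>' h"
proof -
  obtain f :: "real \<Rightarrow> 'a" where f: "continuous_on UNIV f" "S \<subseteq> f ` {0..1}"
    using space_filling_curve[OF compact_imp_bounded[OF S]] by blast
  obtain g where g: "g \<in> borel_measurable borel" "\<And>x. g x \<in> {0..1}" "\<And>x. x \<in> S \<Longrightarrow> f (g x) = x"
    using borel_section[OF f(1) S f(2)] by blast
  have [measurable]: "f \<in> borel_measurable borel" "g \<in> borel_measurable borel"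
    using f g by (auto intro: borel_measurable_continuous_onI)
  have gm [measurable]: "g \<in> measurable (\<mu> n) borel" for n
    using g(1) sets by (simp cong: measurable_cong_sets)
  define \<rho> where "\<rho> = (\<lambda>n. distr (\<mu> n) borel g)"
  have rd: "real_distribution (\<rho> n)" for n
    unfolding \<rho>_def real_distribution_def real_distribution_axioms_def
    by (auto intro!: prob_space.prob_space_distr[OF prob])
  have "measure (\<rho> n) {-1<..1} = 1" for n
  proof -
    have "g -` {-1<..1} = UNIV" using g(2) by (force simp: atLeastAtMost_iff)
    thus ?thesis
      using prob_space.prob_space[OF prob[of n]] by (simp add: \<rho>_def measure_distr)
  qed
  hence tight: "tight \<rho>"
    unfolding tight_def using rd by (intro conjI allI impI exI[of _ "-1"] exI[of _ 1]) auto
  obtain r \<rho>' where r: "strict_mono r" and rd': "real_distribution \<rho>'"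
    and wc: "weak_conv_m (\<rho> \<circ> r) \<rho>'"
    using tight_imp_convergent_subsubsequence[OF tight, of id] by (auto simp: strict_mono_id)
  have sets': "sets \<rho>' = sets borel" using rd' by (simp add: real_distribution_def real_distribution_axioms_def)
  hence [measurable]: "f \<in> measurable \<rho>' borel" by (simp cong: measurable_cong_sets)
  define \<mu>' where "\<mu>' = distr \<rho>' borel f"
  have p': "prob_space \<mu>'" unfolding \<mu>'_def using rd'
    by (intro prob_space.prob_space_distr) (auto simp: real_distribution_def)
  have conv: "(\<lambda>n. integral\<^sup>L (\<mu> (r n)) h) \<longlonglongrightarrow> integral\<^sup>L \<mu>' h"
    if h: "continuous_on UNIV h" "bounded (range h)" for h :: "'a \<Rightarrow> real"
  proof -
    have [measurable]: "h \<in> borel_measurable borel" using h by (auto intro: borel_measurable_continuous_onI)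
    have hm [measurable]: "h \<in> measurable (\<mu> n) borel" for n
      using sets by (simp cong: measurable_cong_sets)
    obtain B where B: "\<And>x. norm (h x) \<le> B" using h(2) by (auto simp: bounded_iff)
    have "continuous_on UNIV (h \<circ> f)" using f(1) h(1) by (intro continuous_on_compose) (auto intro: continuous_on_subset)
    hence cont: "isCont (h \<circ> f) t" for t using continuous_on_eq_continuous_at[OF open_UNIV] by blast
    have "(\<lambda>n. integral\<^sup>L ((\<rho> \<circ> r) n) (h \<circ> f)) \<longlonglongrightarrow> integral\<^sup>L \<rho>' (h \<circ> f)"
      by (rule weak_conv_imp_integral_bdd_continuous_conv[OF _ rd' wc cont, of B]) (use rd B in auto)
    moreover have "integral\<^sup>L ((\<rho> \<circ> r) n) (h \<circ> f) = integral\<^sup>L (\<mu> (r n)) h" for n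
    proof -
      have "integral\<^sup>L ((\<rho> \<circ> r) n) (h \<circ> f) = integral\<^sup>L (\<mu> (r n)) (\<lambda>x. h (f (g x)))"
        unfolding \<rho>_def by (simp add: integral_distr)
      also have "\<dots> = integral\<^sup>L (\<mu> (r n)) h"
        using supp[of "r n"] g(3) by (intro integral_cong_AE) (auto elim: eventually_mono)
      finally show ?thesis .
    qed
    moreover have "integral\<^sup>L \<rho>' (h \<circ> f) = integral\<^sup>L \<mu>' h"
      unfolding \<mu>'_def by (simp add: integral_distr o_def)
    ultimately show ?thesis by simp
  qed
  have "AE x in \<mu>'. x \<in> S"
  proof -
    interpret \<mu>': prob_space \<mu>' by (rule p')
    define h where "h = (\<lambda>x. min 1 (infdist x S))"
    have h: "continuous_on UNIV h" "bounded (range h)"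
      unfolding h_def by (auto intro!: continuous_intros boundedI[of _ 1] simp: infdist_nonneg)
    have [measurable]: "h \<in> borel_measurable borel" using h by (auto intro: borel_measurable_continuous_onI)
    have "integral\<^sup>L (\<mu> n) h = integral\<^sup>L (\<mu> n) (\<lambda>_. 0)" for n
    proof (rule integral_cong_AE)
      show "h \<in> borel_measurable (\<mu> n)"
        using \<open>h \<in> borel_measurable borel\<close> sets by (simp cong: measurable_cong_sets)
      show "AE x in \<mu> n. h x = 0"
        using supp[of n] by (rule eventually_mono) (simp add: h_def)
    qed simp
    hence i0: "integral\<^sup>L \<mu>' h = 0" using conv[OF h] by (simp add: LIMSEQ_const_iff)
    have "integrable \<mu>' h"
      by (rule \<mu>'.integrable_const_bound[of _ 1]) (auto simp: h_def infdist_nonneg \<mu>'_def intro!: borel_measurable_min borel_measurable_continuous_onI continuous_intros)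
    moreover have "AE x in \<mu>'. 0 \<le> h x" by (auto simp: h_def infdist_nonneg)
    ultimately have "AE x in \<mu>'. h x = 0" using i0 by (simp add: integral_nonneg_eq_0_iff_AE)
    moreover have ne: "S \<noteq> {}"
    proof
      assume "S = {}"
      hence "AE x in \<mu> 0. False" using supp[of 0] by simp
      thus False using prob_space.AE_False[OF prob[of 0]] by simp
    qed
    have "x \<in> S" if "h x = 0" for x
      using that in_closed_iff_infdist_zero[OF compact_imp_closed[OF S] ne, of x] by (auto simp: h_def min_def split: if_splits)
    ultimately show ?thesis by (auto elim: eventually_mono)
  qed
  thus ?thesis using that[OF r p' _ _ conv] by (simp add: \<mu>'_def)
qed

text \<open>
  Indicators of closed sets are limits of the continuous functions \<open>max 0 (1 - n * infdist x A)\<close>,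
  and closed sets generate the Borel sets.
\<close>

lemma prob_measure_eqI_continuous:
  fixes \<mu> \<nu> :: "'a :: euclidean_space measure"
  assumes prob: "prob_space \<mu>" "prob_space \<nu>" and sets: "sets \<mu> = sets borel" "sets \<nu> = sets borel"
    and eq: "\<And>h :: 'a \<Rightarrow> real. \<lbrakk>continuous_on UNIV h; bounded (range h)\<rbrakk> \<Longrightarrow> integral\<^sup>L \<mu> h = integral\<^sup>L \<nu> h"
  shows "\<mu> = \<nu>"
proof -
  define h where "h = (\<lambda>A n (x::'a). max 0 (1 - real n * infdist x A))"
  have lim: "(\<lambda>n. integral\<^sup>L N (h A n)) \<longlonglongrightarrow> measure N A"
    if N: "prob_space N" "sets N = sets borel" and A: "closed A" "A \<noteq> {}" for N A
  proof -
    interpret N: prob_space N by fact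
    have [measurable]: "h A n \<in> borel_measurable N" for n
      using N(2) unfolding h_def
      by (auto intro!: borel_measurable_continuous_onI continuous_intros cong: measurable_cong_sets)
    have [measurable]: "A \<in> sets N" using N A by auto
    have "(\<lambda>n. integral\<^sup>L N (h A n)) \<longlonglongrightarrow> integral\<^sup>L N (indicator A :: 'a \<Rightarrow> real)"
    proof (rule integral_dominated_convergence[where w="\<lambda>_. 1"])
      show "AE x in N. (\<lambda>n. h A n x) \<longlonglongrightarrow> indicator A x"
      proof (rule AE_I2)
        fix x
        show "(\<lambda>n. h A n x) \<longlonglongrightarrow> indicator A x"
        proof (cases "x \<in> A")
          case True thus ?thesis by (simp add: h_def)
        next
          case False
          hence d: "infdist x A > 0" using A by (simp add: infdist_pos_not_in_closed)
          obtain n0 where n0: "1 < real n0 * infdist x A" using reals_Archimedean3[OF d] by blast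
          have "h A n x = 0" if "n \<ge> n0" for n
          proof -
            have "real n0 * infdist x A \<le> real n * infdist x A"
              using that by (intro mult_right_mono) (auto simp: infdist_nonneg)
            thus ?thesis using n0 by (simp add: h_def)
          qed
          thus ?thesis using False
            by (intro tendsto_eventually) (auto simp: eventually_sequentially)
        qed
      qed
      show "AE x in N. norm (h A n x) \<le> 1" for n
        by (auto simp: h_def infdist_nonneg)
    qed auto
    thus ?thesis by (simp add: \<open>A \<in> sets N\<close>)
  qed
  have hc: "continuous_on UNIV (h A n)" "bounded (range (h A n))" for A n
    unfolding h_def by (auto intro!: continuous_intros boundedI[of _ 1] simp: infdist_nonneg)
  have clos: "emeasure \<mu> A = emeasure \<nu> A" if "closed A" for A
  proof (cases "A = {}")
    case False
    have "measure \<mu> A = measure \<nu> A"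
      using LIMSEQ_unique[OF lim[OF prob(1) sets(1) that False]] lim[OF prob(2) sets(2) that False] eq[OF hc]
      by simp
    thus ?thesis using prob by (simp add: finite_measure.emeasure_eq_measure prob_space_def)
  qed simp
  show ?thesis
  proof (rule measure_eqI_generator_eq[where \<Omega>=UNIV and E="Collect closed" and A="\<lambda>_. UNIV"])
    show "Int_stable (Collect closed :: 'a set set)" by (auto simp: Int_stable_def)
    show "sets \<mu> = sigma_sets UNIV (Collect closed)" "sets \<nu> = sigma_sets UNIV (Collect closed)"
      using sets by (simp_all add: borel_eq_closed)
    show "emeasure \<mu> UNIV \<noteq> \<infinity>" for i :: nat
      using prob(1) by (simp add: finite_measure.emeasure_eq_measure prob_space_def)
  qed (use clos in auto)
qed

lemma common_subsequence:
  fixes P :: "'i \<Rightarrow> (nat \<Rightarrow> nat) \<Rightarrow> bool"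
  assumes "finite I"
    and ex: "\<And>i s. \<lbrakk>i \<in> I; strict_mono s\<rbrakk> \<Longrightarrow> \<exists>r :: nat \<Rightarrow> nat. strict_mono r \<and> P i (s \<circ> r)"
    and sub: "\<And>i s r. \<lbrakk>P i s; strict_mono (r :: nat \<Rightarrow> nat)\<rbrakk> \<Longrightarrow> P i (s \<circ> r)"
  shows "\<exists>s. strict_mono s \<and> (\<forall>i\<in>I. P i s)"
  using assms(1) ex
proof (induction I rule: finite_induct)
  case empty show ?case by (auto intro: strict_mono_id)
next
  case (insert j I)
  then obtain s where s: "strict_mono s" "\<forall>i\<in>I. P i s" by blast
  obtain r where "strict_mono r" "P j (s \<circ> r)" using insert.prems s(1) by blast
  thus ?case using s sub by (auto intro!: exI[of _ "s \<circ> r"] strict_mono_o)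
qed

text \<open>
  Both marginals of a coupling, and the cost if it is continuous, are integrals of continuous
  functions, so they pass to weak limits. Since the couplings share their second marginal along
  the sequence, so do the limits; this is why a common subsequence is chosen.
\<close>

lemma couplings_compact_subsequence:
  fixes \<pi> :: "nat \<Rightarrow> 'i \<Rightarrow> ('a :: euclidean_space \<times> 'a) measure"
    and c :: "'a \<times> 'a \<Rightarrow> real"
  assumes I: "finite I" and C: "compact C"
    and prob: "\<And>n i. i \<in> I \<Longrightarrow> prob_space (\<pi> n i)"
    and sets: "\<And>n i. i \<in> I \<Longrightarrow> sets (\<pi> n i) = sets borel"
    and supp: "\<And>n i. i \<in> I \<Longrightarrow> AE z in \<pi> n i. z \<in> C \<times> C"
    and fst: "\<And>n i. i \<in> I \<Longrightarrow> distr (\<pi> n i) borel fst = \<mu> i"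
    and snd: "\<And>n i. i \<in> I \<Longrightarrow> distr (\<pi> n i) borel snd = \<rho> n"
    and c: "continuous_on (C \<times> C) c" "\<And>z. z \<in> C \<times> C \<Longrightarrow> 0 \<le> c z"
  obtains r \<pi>' \<rho>' where "strict_mono r"
    "\<And>i. i \<in> I \<Longrightarrow> prob_space (\<pi>' i)" "\<And>i. i \<in> I \<Longrightarrow> sets (\<pi>' i) = sets borel"
    "\<And>i. i \<in> I \<Longrightarrow> AE z in \<pi>' i. z \<in> C \<times> C"
    "\<And>i. i \<in> I \<Longrightarrow> distr (\<pi>' i) borel fst = \<mu> i"
    "\<And>i. i \<in> I \<Longrightarrow> distr (\<pi>' i) borel snd = \<rho>'"
    "\<And>i. i \<in> I \<Longrightarrow> (\<lambda>n. \<integral>\<^sup>+ z. ennreal (c z) \<partial>\<pi> (r n) i) \<longlonglongrightarrow> (\<integral>\<^sup>+ z. ennreal (c z) \<partial>\<pi>' i)"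
proof -
  define lim where "lim = (\<lambda>i (r :: nat \<Rightarrow> nat) N. prob_space N \<and> sets N = sets borel
      \<and> (AE z in N. z \<in> C \<times> C)
      \<and> (\<forall>h :: 'a \<times> 'a \<Rightarrow> real. continuous_on UNIV h \<longrightarrow> bounded (range h) \<longrightarrow>
           (\<lambda>n. integral\<^sup>L (\<pi> (r n) i) h) \<longlonglongrightarrow> integral\<^sup>L N h))"
  have "\<exists>r. strict_mono r \<and> (\<forall>i\<in>I. \<exists>N. lim i r N)"
  proof (rule common_subsequence[OF I])
    fix i and s :: "nat \<Rightarrow> nat" assume i: "i \<in> I" and s: "strict_mono s"
    show "\<exists>r. strict_mono r \<and> (\<exists>N. lim i (s \<circ> r) N)"
      using prob_measure_compact_subsequence[OF compact_Times[OF C C], of "\<lambda>n. \<pi> (s n) i"] prob[OF i] sets[OF i] supp[OF i]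
      unfolding lim_def o_def by metis
  next
    fix i s and r :: "nat \<Rightarrow> nat" assume ex: "\<exists>N. lim i s N" and r: "strict_mono r"
    from ex obtain N where N: "lim i s N" by blast
    have "lim i (s \<circ> r) N" using N LIMSEQ_subseq_LIMSEQ[OF _ r] unfolding lim_def o_def by fast
    thus "\<exists>N. lim i (s \<circ> r) N" by blast
  qed
  then obtain r where r: "strict_mono r" "\<forall>i\<in>I. \<exists>N. lim i r N" by blast
  then obtain \<pi>' where lim: "\<And>i. i \<in> I \<Longrightarrow> lim i r (\<pi>' i)" by metis
  hence p': "prob_space (\<pi>' i)" and s': "sets (\<pi>' i) = sets borel"
    and a': "AE z in \<pi>' i. z \<in> C \<times> C" if "i \<in> I" for i
    using that by (auto simp: lim_def)
  have conv: "(\<lambda>n. integral\<^sup>L (\<pi> (r n) i) h) \<longlonglongrightarrow> integral\<^sup>L (\<pi>' i) h"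
    if "i \<in> I" "continuous_on UNIV h" "bounded (range h)" for i and h :: "'a \<times> 'a \<Rightarrow> real"
    using lim that by (auto simp: lim_def)
  have mbl: "f \<in> measurable N borel" if "sets N = sets borel" "f \<in> borel_measurable borel"
    for N and f :: "'a \<times> 'a \<Rightarrow> 'c :: euclidean_space"
    using that by (simp cong: measurable_cong_sets)
  have fsm: "fst \<in> borel_measurable (borel :: ('a \<times> 'a) measure)"
     "snd \<in> borel_measurable (borel :: ('a \<times> 'a) measure)"
    by (auto intro!: borel_measurable_continuous_onI continuous_intros)
  have marg: "(\<lambda>n. integral\<^sup>L (distr (\<pi> (r n) i) borel p) h) \<longlonglongrightarrow> integral\<^sup>L (distr (\<pi>' i) borel p) h"
    if i: "i \<in> I" and h: "continuous_on UNIV h" "bounded (range h)" and p: "continuous_on UNIV p"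
    for i and h :: "'a \<Rightarrow> real" and p :: "'a \<times> 'a \<Rightarrow> 'a"
  proof -
    have pm: "p \<in> borel_measurable borel" "h \<in> borel_measurable borel"
      using p h by (auto intro: borel_measurable_continuous_onI)
    have "continuous_on UNIV (\<lambda>z. h (p z))" using continuous_on_compose2[OF h(1) p] by simp
    moreover have "bounded (range (\<lambda>z. h (p z)))" using h(2) by (rule bounded_subset) auto
    ultimately have "(\<lambda>n. \<integral>z. h (p z) \<partial>\<pi> (r n) i) \<longlonglongrightarrow> (\<integral>z. h (p z) \<partial>\<pi>' i)" by (rule conv[OF i])
    thus ?thesis using pm by (simp add: integral_distr mbl sets s' i)
  qed
  have pd: "prob_space (distr (\<pi>' i) borel fst)" "prob_space (distr (\<pi>' i) borel snd)" if "i \<in> I" for i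
    using that fsm by (auto intro!: prob_space.prob_space_distr p' mbl s')
  have F: "distr (\<pi>' i) borel fst = \<mu> i" if i: "i \<in> I" for i
  proof (rule prob_measure_eqI_continuous)
    show "prob_space (\<mu> i)" "sets (\<mu> i) = sets borel"
      unfolding fst[OF i, of 0, symmetric]
      using i fsm by (auto intro!: prob_space.prob_space_distr prob mbl sets)
    fix h :: "'a \<Rightarrow> real" assume h: "continuous_on UNIV h" "bounded (range h)"
    show "integral\<^sup>L (distr (\<pi>' i) borel fst) h = integral\<^sup>L (\<mu> i) h"
      using marg[OF i h continuous_on_fst[OF continuous_on_id]] fst[OF i] by (simp add: LIMSEQ_const_iff)
  qed (use pd i in auto)
  have S: "distr (\<pi>' i) borel snd = distr (\<pi>' j) borel snd" if i: "i \<in> I" and j: "j \<in> I" for i j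
  proof (rule prob_measure_eqI_continuous)
    fix h :: "'a \<Rightarrow> real" assume h: "continuous_on UNIV h" "bounded (range h)"
    note m = marg[OF _ h continuous_on_snd[OF continuous_on_id]]
    show "integral\<^sup>L (distr (\<pi>' i) borel snd) h = integral\<^sup>L (distr (\<pi>' j) borel snd) h"
      using LIMSEQ_unique[OF m[OF i]] m[OF j] snd[OF i] snd[OF j] by simp
  qed (use pd i j in auto)
  obtain \<rho>' where R: "\<And>i. i \<in> I \<Longrightarrow> distr (\<pi>' i) borel snd = \<rho>'"
    using S by (metis)
  have V: "(\<lambda>n. \<integral>\<^sup>+ z. ennreal (c z) \<partial>\<pi> (r n) i) \<longlonglongrightarrow> (\<integral>\<^sup>+ z. ennreal (c z) \<partial>\<pi>' i)" if i: "i \<in> I" for i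
  proof -
    have "compact (c ` (C \<times> C))" by (intro compact_continuous_image c compact_Times C)
    then obtain B where B: "B > 0" "\<And>z. z \<in> C \<times> C \<Longrightarrow> norm (c z) \<le> B"
      using compact_imp_bounded[of "c ` (C \<times> C)"] unfolding bounded_pos by auto
    obtain g where g: "continuous_on UNIV g" "\<And>z. z \<in> C \<times> C \<Longrightarrow> g z = c z" "\<And>z. norm (g z) \<le> B"
      using Tietze[OF c(1), of UNIV B] B C by (auto simp: compact_imp_closed closed_Times)
    define h where "h = (\<lambda>z. max 0 (g z))"
    have h: "continuous_on UNIV h" "bounded (range h)"
    proof -
      show "continuous_on UNIV h" unfolding h_def by (intro continuous_intros g(1))
      show "bounded (range h)" using g(3) B(1) by (auto intro!: boundedI[of _ B] simp: h_def abs_le_iff)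
    qed
    have hB: "\<bar>h z\<bar> \<le> B" for z using g(3)[of z] B(1) by (auto simp: h_def)
    have eq: "(\<integral>\<^sup>+ z. ennreal (c z) \<partial>N) = ennreal (integral\<^sup>L N h)"
      if N: "prob_space N" "sets N = sets borel" "AE z in N. z \<in> C \<times> C" for N
    proof -
      interpret N: prob_space N by fact
      have "(\<integral>\<^sup>+ z. ennreal (c z) \<partial>N) = (\<integral>\<^sup>+ z. ennreal (h z) \<partial>N)"
        using N(3) g(2) c(2) by (intro nn_integral_cong_AE) (auto simp: h_def elim!: eventually_mono)
      also have "\<dots> = ennreal (integral\<^sup>L N h)"
      proof (rule nn_integral_eq_integral)
        show "integrable N h"
          by (rule N.integrable_const_bound[of _ B])
            (auto simp: hB intro!: mbl N borel_measurable_continuous_onI h)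
      qed (auto simp: h_def)
      finally show ?thesis .
    qed
    show ?thesis
      unfolding eq[OF prob[OF i] sets[OF i] supp[OF i]] eq[OF p'[OF i] s'[OF i] a'[OF i]]
      by (intro tendsto_ennrealI conv i h)
  qed
  show ?thesis using that[OF r(1) p' s' a' F R V] by blast
qed

section \<open>Conditional means and barycentric projections\<close>

text \<open>
  The function \<open>t\<close> is the conditional expectation of \<open>h\<close> given \<open>q\<close>, but as a function on the target
  of \<open>q\<close>. This form makes it possible to compare conditional means of several couplings that
  share the law of \<open>q\<close>.
\<close>

lemma conditional_mean_real:
  fixes h :: "'a \<Rightarrow> real" and q :: "'a \<Rightarrow> 'b"
  assumes prob: "prob_space \<pi>" and q [measurable]: "q \<in> measurable \<pi> N"
    and h [measurable]: "h \<in> borel_measurable \<pi>" and bnd: "AE z in \<pi>. \<bar>h z\<bar> \<le> R"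
  obtains t where "t \<in> borel_measurable N" "integrable (distr \<pi> N q) t"
    "\<And>u :: 'b \<Rightarrow> real. \<lbrakk>u \<in> borel_measurable N; bounded (range u)\<rbrakk>
       \<Longrightarrow> (\<integral>z. u (q z) * h z \<partial>\<pi>) = (\<integral>x. u x * t x \<partial>distr \<pi> N q)"
proof -
  interpret prob_space \<pi> by fact
  define \<rho> where "\<rho> = distr \<pi> N q"
  interpret \<rho>: prob_space \<rho> unfolding \<rho>_def by (rule prob_space_distr) simp
  \<comment> \<open>Shifted by \<open>R\<close> the function is the density of a positive measure, to which
    Radon-Nikodym applies.\<close>
  define k where "k = (\<lambda>z. max 0 (h z + R))"
  have [measurable]: "k \<in> borel_measurable \<pi>" by (simp add: k_def)
  have k0: "0 \<le> k z" for z by (simp add: k_def)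
  have ki: "integrable \<pi> k"
  proof (rule integrable_const_bound[of _ "2 * R"])
    show "AE z in \<pi>. norm (k z) \<le> 2 * R"
      using bnd by (rule eventually_mono) (auto simp: k_def)
  qed measurable
  define \<sigma> where "\<sigma> = distr (density \<pi> (\<lambda>z. ennreal (k z))) N q"
  have qd [measurable]: "q \<in> measurable (density \<pi> (\<lambda>z. ennreal (k z))) N" by simp
  have em: "emeasure \<sigma> A = (\<integral>\<^sup>+ z. ennreal (k z) * indicator (q -` A \<inter> space \<pi>) z \<partial>\<pi>)"
    if "A \<in> sets N" for A
    using that by (simp add: \<sigma>_def emeasure_distr emeasure_density)
  have fin: "finite_measure \<sigma>"
  proof
    have "emeasure \<sigma> (space N) \<le> (\<integral>\<^sup>+ z. ennreal (k z) \<partial>\<pi>)"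
      unfolding em[OF sets.top] by (intro nn_integral_mono) (auto split: split_indicator)
    hence "emeasure \<sigma> (space \<sigma>) \<le> (\<integral>\<^sup>+ z. ennreal (k z) \<partial>\<pi>)"
      by (simp add: \<sigma>_def)
    also have "\<dots> < \<infinity>" using ki k0 by (simp add: nn_integral_eq_integral)
    finally show "emeasure \<sigma> (space \<sigma>) \<noteq> \<infinity>" by simp
  qed
  have ac: "absolutely_continuous \<rho> \<sigma>"
    unfolding absolutely_continuous_def
  proof
    fix A assume "A \<in> null_sets \<rho>"
    hence A: "A \<in> sets N" and "emeasure (distr \<pi> N q) A = 0"
      by (simp_all add: null_sets_def \<rho>_def)
    hence null: "emeasure \<pi> (q -` A \<inter> space \<pi>) = 0" by (simp add: emeasure_distr)
    have "q -` A \<inter> space \<pi> \<in> null_sets \<pi>"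
      using null measurable_sets[OF q A] by (simp add: null_sets_def)
    from AE_not_in[OF this]
    have "(\<integral>\<^sup>+ z. ennreal (k z) * indicator (q -` A \<inter> space \<pi>) z \<partial>\<pi>) = (\<integral>\<^sup>+ z. 0 \<partial>\<pi>)"
      by (intro nn_integral_cong_AE) (auto elim: eventually_mono)
    thus "A \<in> null_sets \<sigma>" using em[OF A] A by (simp add: null_sets_def \<sigma>_def)
  qed
  have se: "sets \<sigma> = sets \<rho>" by (simp add: \<sigma>_def \<rho>_def)
  obtain D where D: "D \<in> borel_measurable \<rho>" "AE x in \<rho>. RN_deriv \<rho> \<sigma> x = ennreal (D x)"
      "\<And>x. 0 \<le> D x"
    using \<rho>.real_RN_deriv[OF fin ac se] by blast
  have D' [measurable]: "D \<in> borel_measurable N" using D(1) by (simp add: \<rho>_def)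
  have "\<sigma> = density \<rho> (RN_deriv \<rho> \<sigma>)"
    using \<rho>.density_RN_deriv[OF ac se] by simp
  also have "\<dots> = density \<rho> (\<lambda>x. ennreal (D x))"
    using D by (intro density_cong) auto
  finally have dens: "\<sigma> = density \<rho> (\<lambda>x. ennreal (D x))" .
  have int\<sigma>: "(\<integral>x. u x \<partial>\<sigma>) = (\<integral>z. k z * u (q z) \<partial>\<pi>)"
    and int\<sigma>': "(\<integral>x. u x \<partial>\<sigma>) = (\<integral>x. D x * u x \<partial>\<rho>)"
    if [measurable]: "u \<in> borel_measurable N" for u :: "'b \<Rightarrow> real"
  proof -
    show "(\<integral>x. u x \<partial>\<sigma>) = (\<integral>z. k z * u (q z) \<partial>\<pi>)"
      unfolding \<sigma>_def by (subst integral_distr) (auto simp: integral_density k0)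
    show "(\<integral>x. u x \<partial>\<sigma>) = (\<integral>x. D x * u x \<partial>\<rho>)"
      unfolding dens using D by (subst integral_density) (auto simp: \<rho>_def)
  qed
  have "emeasure \<sigma> (space \<sigma>) = (\<integral>\<^sup>+ x. ennreal (D x) \<partial>\<rho>)"
    unfolding dens using D(1) by (simp add: emeasure_density)
  hence Di: "integrable \<rho> D"
    using finite_measure.emeasure_finite[OF fin, of "space \<sigma>"] D
    by (intro integrableI_nonneg) (auto simp: less_top)
  show ?thesis
  proof (rule that)
    show "(\<lambda>x. D x - R) \<in> borel_measurable N" by simp
    show "integrable (distr \<pi> N q) (\<lambda>x. D x - R)" using Di by (simp flip: \<rho>_def)
    fix u :: "'b \<Rightarrow> real" assume u [measurable]: "u \<in> borel_measurable N" and "bounded (range u)"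
    then obtain B where B: "\<And>x. \<bar>u x\<bar> \<le> B" by (auto simp: bounded_iff)
    have uq: "integrable \<pi> (\<lambda>z. u (q z))"
      by (rule integrable_const_bound[of _ B]) (auto simp: B)
    have ui: "integrable \<rho> u"
      by (rule \<rho>.integrable_const_bound[of _ B]) (auto simp: B \<rho>_def)
    have ku: "integrable \<pi> (\<lambda>z. k z * u (q z))"
    proof (rule Bochner_Integration.integrable_bound[OF integrable_mult_left[OF ki, of B]])
      show "AE z in \<pi>. norm (k z * u (q z)) \<le> norm (k z * B)"
        by (intro AE_I2) (simp add: abs_mult mult_left_mono order.trans[OF B abs_ge_self])
    qed measurable
    have Du: "integrable \<rho> (\<lambda>z. D z * u z)"
    proof (rule Bochner_Integration.integrable_bound[OF integrable_mult_left[OF Di, of B]])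
      show "AE x in \<rho>. norm (D x * u x) \<le> norm (D x * B)"
        by (intro AE_I2) (simp add: abs_mult mult_left_mono order.trans[OF B abs_ge_self])
      show "(\<lambda>x. D x * u x) \<in> borel_measurable \<rho>" by (simp add: \<rho>_def)
    qed
    have "(\<integral>z. u (q z) * h z \<partial>\<pi>) = (\<integral>z. k z * u (q z) - R * u (q z) \<partial>\<pi>)"
      by (rule integral_cong_AE) (use bnd in \<open>auto simp: k_def algebra_simps elim!: eventually_mono\<close>)
    also have "\<dots> = (\<integral>z. k z * u (q z) \<partial>\<pi>) - R * (\<integral>z. u (q z) \<partial>\<pi>)"
      using uq ku by simp
    also have "(\<integral>z. k z * u (q z) \<partial>\<pi>) = (\<integral>x. D x * u x \<partial>\<rho>)"
      using int\<sigma>[OF u] int\<sigma>'[OF u] by simp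
    also have "(\<integral>z. u (q z) \<partial>\<pi>) = (\<integral>x. u x \<partial>\<rho>)"
      unfolding \<rho>_def by (simp add: integral_distr)
    also have "(\<integral>x. D x * u x \<partial>\<rho>) - R * (\<integral>x. u x \<partial>\<rho>) = (\<integral>x. u x * (D x - R) \<partial>\<rho>)"
      using ui Du by (simp add: algebra_simps)
    finally show "(\<integral>z. u (q z) * h z \<partial>\<pi>) = (\<integral>x. u x * (D x - R) \<partial>distr \<pi> N q)"
      by (simp only: \<rho>_def)
  qed
qed

lemma conditional_mean:
  fixes h :: "'a \<Rightarrow> 'c :: euclidean_space" and q :: "'a \<Rightarrow> 'b"
  assumes prob: "prob_space \<pi>" and q [measurable]: "q \<in> measurable \<pi> N"
    and h [measurable]: "h \<in> borel_measurable \<pi>" and bnd: "AE z in \<pi>. norm (h z) \<le> R"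
  obtains m where "m \<in> borel_measurable N" "integrable (distr \<pi> N q) m"
    "\<And>G :: 'b \<Rightarrow> 'c. \<lbrakk>G \<in> borel_measurable N; bounded (range G)\<rbrakk>
       \<Longrightarrow> (\<integral>z. G (q z) \<bullet> h z \<partial>\<pi>) = (\<integral>x. G x \<bullet> m x \<partial>distr \<pi> N q)"
proof -
  interpret prob_space \<pi> by fact
  define \<rho> where "\<rho> = distr \<pi> N q"
  define Q where "Q = (\<lambda>b t. t \<in> borel_measurable N \<and> integrable \<rho> t \<and> (\<forall>u :: 'b \<Rightarrow> real.
      u \<in> borel_measurable N \<longrightarrow> bounded (range u) \<longrightarrow>
      (\<integral>z. u (q z) * (h z \<bullet> b) \<partial>\<pi>) = (\<integral>x. u x * t x \<partial>\<rho>)))"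
  have "\<forall>b\<in>Basis. \<exists>t. Q b t"
  proof
    fix b :: 'c assume b: "b \<in> Basis"
    have "AE z in \<pi>. \<bar>h z \<bullet> b\<bar> \<le> R"
      using bnd by (rule eventually_mono) (rule order.trans[OF Basis_le_norm[OF b]])
    moreover have "(\<lambda>z. h z \<bullet> b) \<in> borel_measurable \<pi>" by measurable
    ultimately obtain t where "t \<in> borel_measurable N" "integrable (distr \<pi> N q) t"
      "\<And>u :: 'b \<Rightarrow> real. \<lbrakk>u \<in> borel_measurable N; bounded (range u)\<rbrakk>
         \<Longrightarrow> (\<integral>z. u (q z) * (h z \<bullet> b) \<partial>\<pi>) = (\<integral>x. u x * t x \<partial>distr \<pi> N q)"
      using conditional_mean_real[OF prob q] by blast
    hence "Q b t" unfolding Q_def \<rho>_def by blast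
    thus "\<exists>t. Q b t" by blast
  qed
  from bchoice[OF this] obtain t where "\<forall>b\<in>Basis. Q b (t b)" by blast
  hence t: "\<And>b. b \<in> Basis \<Longrightarrow> t b \<in> borel_measurable N"
    "\<And>b. b \<in> Basis \<Longrightarrow> integrable \<rho> (t b)"
    "\<And>b u. \<lbrakk>b \<in> Basis; u \<in> borel_measurable N; bounded (range u)\<rbrakk> \<Longrightarrow>
      (\<integral>z. u (q z) * (h z \<bullet> b) \<partial>\<pi>) = (\<integral>x. u x * t b x \<partial>\<rho>)"
    unfolding Q_def by blast+
  show ?thesis
  proof (rule that)
    define m where "m = (\<lambda>x. \<Sum>b\<in>Basis. t b x *\<^sub>R b)"
    show "m \<in> borel_measurable N" unfolding m_def
      by (intro borel_measurable_sum borel_measurable_scaleR t) auto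
    show "integrable (distr \<pi> N q) m" unfolding m_def
      by (intro Bochner_Integration.integrable_sum integrable_scaleR_left t(2)[unfolded \<rho>_def])
    fix G :: "'b \<Rightarrow> 'c" assume G [measurable]: "G \<in> borel_measurable N" and bG: "bounded (range G)"
    then obtain B where B: "\<And>x. norm (G x) \<le> B" by (auto simp: bounded_iff)
    have Bb: "\<bar>G x \<bullet> b\<bar> \<le> B" if "b \<in> Basis" for b x
      using Basis_le_norm[OF that, of "G x"] B[of x] by linarith
    have hb: "AE z in \<pi>. \<bar>h z \<bullet> b\<bar> \<le> R" if "b \<in> Basis" for b
      using bnd by (rule eventually_mono) (rule order.trans[OF Basis_le_norm[OF that]])
    have "(\<integral>z. G (q z) \<bullet> h z \<partial>\<pi>) = (\<integral>z. (\<Sum>b\<in>Basis. (G (q z) \<bullet> b) * (h z \<bullet> b)) \<partial>\<pi>)"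
      by (subst euclidean_inner) (rule refl)
    also have "\<dots> = (\<Sum>b\<in>Basis. \<integral>z. (G (q z) \<bullet> b) * (h z \<bullet> b) \<partial>\<pi>)"
    proof (rule Bochner_Integration.integral_sum)
      fix b :: 'c assume b: "b \<in> Basis"
      show "integrable \<pi> (\<lambda>z. (G (q z) \<bullet> b) * (h z \<bullet> b))"
      proof (rule integrable_const_bound[of _ "B * R"])
        show "AE z in \<pi>. norm ((G (q z) \<bullet> b) * (h z \<bullet> b)) \<le> B * R"
          using hb[OF b] Bb[OF b] order.trans[OF abs_ge_zero Bb[OF b]]
          by (auto simp: abs_mult intro!: mult_mono elim!: eventually_mono)
      qed measurable
    qed
    also have "\<dots> = (\<Sum>b\<in>Basis. \<integral>x. (G x \<bullet> b) * t b x \<partial>\<rho>)"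
    proof (rule sum.cong[OF refl])
      fix b :: 'c assume b: "b \<in> Basis"
      show "(\<integral>z. (G (q z) \<bullet> b) * (h z \<bullet> b) \<partial>\<pi>) = (\<integral>x. (G x \<bullet> b) * t b x \<partial>\<rho>)"
        by (rule t(3)[OF b]) (auto intro!: boundedI[of _ B] Bb b)
    qed
    also have "\<dots> = (\<integral>x. (\<Sum>b\<in>Basis. (G x \<bullet> b) * t b x) \<partial>\<rho>)"
    proof (rule Bochner_Integration.integral_sum[symmetric])
      fix b :: 'c assume b: "b \<in> Basis"
      have [measurable]: "t b \<in> borel_measurable \<rho>" "(\<lambda>x. G x \<bullet> b) \<in> borel_measurable \<rho>"
        using t(1)[OF b] by (simp_all add: \<rho>_def)
      show "integrable \<rho> (\<lambda>x. (G x \<bullet> b) * t b x)"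
      proof (rule Bochner_Integration.integrable_bound[OF integrable_mult_right[OF t(2)[OF b], of B]])
        show "AE x in \<rho>. norm ((G x \<bullet> b) * t b x) \<le> norm (B * t b x)"
          by (intro AE_I2) (simp add: abs_mult mult_right_mono order.trans[OF Bb[OF b] abs_ge_self])
      qed measurable
    qed
    also have "\<dots> = (\<integral>x. G x \<bullet> m x \<partial>\<rho>)"
      unfolding m_def by (simp add: inner_sum_right mult.commute)
    finally show "(\<integral>z. G (q z) \<bullet> h z \<partial>\<pi>) = (\<integral>x. G x \<bullet> m x \<partial>distr \<pi> N q)" by (simp only: \<rho>_def)
  qed
qed

text \<open>
  The map \<open>T\<close> sends \<open>y\<close> to the weighted average of the conditional means of the first coordinate
  given that the second one is \<open>y\<close>. That it has values in \<open>C\<close> is a variational fact: if \<open>w y\<close> is the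
  point of \<open>C\<close> closest to the average \<open>M y\<close>, then \<open>(M y - w y) \<bullet> (x - w y) \<le> 0\<close> for all \<open>x\<close> in
  \<open>C\<close>, and conditional averaging over \<open>x\<close> turns this into \<open>norm (M y - w y) ^ 2 \<le> 0\<close> almost
  everywhere. So \<open>T\<close> can be taken to be \<open>w\<close>.
\<close>

lemma barycentric_projection:
  fixes \<pi> :: "'i \<Rightarrow> ('a :: euclidean_space \<times> 'b :: topological_space) measure" and lam :: "'i \<Rightarrow> real"
  assumes C: "compact C" "convex C" "C \<noteq> {}"
    and lam: "\<And>i. i \<in> I \<Longrightarrow> 0 \<le> lam i" "sum lam I = 1"
    and prob: "\<And>i. i \<in> I \<Longrightarrow> prob_space (\<pi> i)"
    and fstm: "\<And>i. i \<in> I \<Longrightarrow> fst \<in> borel_measurable (\<pi> i)"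
    and sndm: "\<And>i. i \<in> I \<Longrightarrow> snd \<in> borel_measurable (\<pi> i)"
    and supp: "\<And>i. i \<in> I \<Longrightarrow> AE z in \<pi> i. fst z \<in> C"
    and snd: "\<And>i. i \<in> I \<Longrightarrow> distr (\<pi> i) borel snd = \<rho>"
  obtains T where "T \<in> borel_measurable borel" "\<And>y. T y \<in> C"
    "\<And>G. \<lbrakk>G \<in> borel_measurable borel; bounded (range G)\<rbrakk>
       \<Longrightarrow> (\<Sum>i\<in>I. lam i * (\<integral>z. G (snd z) \<bullet> (fst z - T (snd z)) \<partial>\<pi> i)) = 0"
proof -
  obtain R where R: "\<And>x. x \<in> C \<Longrightarrow> norm x \<le> R"
    using compact_imp_bounded[OF C(1)] by (auto simp: bounded_iff)
  define Q where "Q = (\<lambda>i m. m \<in> borel_measurable borel \<and> integrable \<rho> m \<and>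
    (\<forall>G :: 'b \<Rightarrow> 'a. G \<in> borel_measurable borel \<longrightarrow> bounded (range G)
       \<longrightarrow> (\<integral>z. G (snd z) \<bullet> fst z \<partial>\<pi> i) = (\<integral>x. G x \<bullet> m x \<partial>\<rho>)))"
  have "\<forall>i\<in>I. \<exists>m. Q i m"
  proof
    fix i assume i: "i \<in> I"
    have "AE z in \<pi> i. norm (fst z) \<le> R" using supp[OF i] by (rule eventually_mono) (rule R)
    from conditional_mean[OF prob[OF i] sndm[OF i] fstm[OF i] this]
    obtain m where "m \<in> borel_measurable borel" "integrable (distr (\<pi> i) borel snd) m"
      "\<And>G :: 'b \<Rightarrow> 'a. \<lbrakk>G \<in> borel_measurable borel; bounded (range G)\<rbrakk>
         \<Longrightarrow> (\<integral>z. G (snd z) \<bullet> fst z \<partial>\<pi> i) = (\<integral>x. G x \<bullet> m x \<partial>distr (\<pi> i) borel snd)" by blast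
    hence "Q i m" unfolding Q_def snd[OF i] by blast
    thus "\<exists>m. Q i m" by blast
  qed
  from bchoice[OF this] obtain m where "\<forall>i\<in>I. Q i (m i)" by blast
  hence m: "\<And>i. i \<in> I \<Longrightarrow> m i \<in> borel_measurable borel"
    "\<And>i. i \<in> I \<Longrightarrow> integrable \<rho> (m i)"
    "\<And>i G. \<lbrakk>i \<in> I; G \<in> borel_measurable borel; bounded (range G)\<rbrakk> \<Longrightarrow>
       (\<integral>z. G (snd z) \<bullet> fst z \<partial>\<pi> i) = (\<integral>x. G x \<bullet> m i x \<partial>\<rho>)"
    unfolding Q_def by blast+
  have "I \<noteq> {}" using lam(2) by auto
  then obtain j where j: "j \<in> I" by blast
  interpret \<rho>: prob_space \<rho> unfolding snd[OF j, symmetric] by (rule prob_space.prob_space_distr[OF prob[OF j] sndm[OF j]])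
  have s\<rho> [measurable_cong]: "sets \<rho> = sets borel" unfolding snd[OF j, symmetric] by simp
  define M where "M = (\<lambda>y. \<Sum>i\<in>I. lam i *\<^sub>R m i y)"
  have Mm [measurable]: "M \<in> borel_measurable borel" unfolding M_def
    by (intro borel_measurable_sum borel_measurable_scaleR m) auto
  have Mi: "integrable \<rho> M" unfolding M_def
    by (intro Bochner_Integration.integrable_sum integrable_scaleR_right m)
  have inner_int: "integrable \<rho> (\<lambda>y. G y \<bullet> u y)"
    if [measurable]: "G \<in> borel_measurable borel" and bG: "bounded (range G)" and ui: "integrable \<rho> u"
    for G u :: "'b \<Rightarrow> 'a"
  proof -
    obtain B where B: "\<And>y. norm (G y) \<le> B" using bG by (auto simp: bounded_iff)
    have [measurable]: "u \<in> borel_measurable \<rho>" "G \<in> borel_measurable \<rho>" using ui by auto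
    show ?thesis
    proof (rule Bochner_Integration.integrable_bound[OF integrable_mult_right[OF integrable_norm[OF ui], of B]])
      show "AE y in \<rho>. norm (G y \<bullet> u y) \<le> norm (B * norm (u y))"
      proof (rule AE_I2)
        fix y
        have "norm (G y \<bullet> u y) \<le> norm (G y) * norm (u y)" by (simp add: Cauchy_Schwarz_ineq2)
        also have "\<dots> \<le> B * norm (u y)" by (intro mult_right_mono B) auto
        finally show "norm (G y \<bullet> u y) \<le> norm (B * norm (u y))" by simp
      qed
    qed measurable
  qed
  \<comment> \<open>The defining property of the averaged conditional mean \<open>M\<close>, against any shift by a
    bounded function of the second coordinate.\<close>
  have key: "(\<Sum>i\<in>I. lam i * (\<integral>z. G (snd z) \<bullet> (fst z - w (snd z)) \<partial>\<pi> i)) = (\<integral>y. G y \<bullet> (M y - w y) \<partial>\<rho>)"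
    if G [measurable]: "G \<in> borel_measurable borel" and bG: "bounded (range G)"
      and w [measurable]: "w \<in> borel_measurable borel" and bw: "bounded (range w)"
    for G w :: "'b \<Rightarrow> 'a"
  proof -
    obtain B where B: "\<And>y. norm (G y) \<le> B" using bG by (auto simp: bounded_iff)
    obtain W where W: "\<And>y. norm (w y) \<le> W" using bw by (auto simp: bounded_iff)
    have wi: "integrable \<rho> w" by (rule \<rho>.integrable_const_bound[of _ W]) (auto simp: W)
    have "(\<integral>z. G (snd z) \<bullet> (fst z - w (snd z)) \<partial>\<pi> i) = (\<integral>y. G y \<bullet> m i y \<partial>\<rho>) - (\<integral>y. G y \<bullet> w y \<partial>\<rho>)"
      if i: "i \<in> I" for i
    proof -
      interpret prob_space "\<pi> i" by (rule prob[OF i])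
      note [measurable] = fstm[OF i] sndm[OF i]
      have b1: "\<bar>G y \<bullet> x\<bar> \<le> B * r" if "norm x \<le> r" for x r y
      proof -
        have "\<bar>G y \<bullet> x\<bar> \<le> norm (G y) * norm x" by (rule Cauchy_Schwarz_ineq2)
        also have "\<dots> \<le> B * r"
          by (intro mult_mono B that order.trans[OF norm_ge_zero B]) auto
        finally show ?thesis .
      qed
      have "integrable (\<pi> i) (\<lambda>z. G (snd z) \<bullet> fst z)"
      proof (rule integrable_const_bound)
        show "AE z in \<pi> i. norm (G (snd z) \<bullet> fst z) \<le> B * R"
          using supp[OF i] by (rule eventually_mono) (simp add: b1 R)
      qed measurable
      moreover have "integrable (\<pi> i) (\<lambda>z. G (snd z) \<bullet> w (snd z))"
        by (rule integrable_const_bound[of _ "B * W"]) (auto simp: b1 W)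
      ultimately have "(\<integral>z. G (snd z) \<bullet> (fst z - w (snd z)) \<partial>\<pi> i)
          = (\<integral>z. G (snd z) \<bullet> fst z \<partial>\<pi> i) - (\<integral>z. G (snd z) \<bullet> w (snd z) \<partial>\<pi> i)"
        by (simp add: inner_diff_right)
      also have "(\<integral>z. G (snd z) \<bullet> w (snd z) \<partial>\<pi> i) = (\<integral>y. G y \<bullet> w y \<partial>distr (\<pi> i) borel snd)"
        by (subst integral_distr) auto
      finally show ?thesis using m(3)[OF i G bG] snd[OF i] by simp
    qed
    hence "(\<Sum>i\<in>I. lam i * (\<integral>z. G (snd z) \<bullet> (fst z - w (snd z)) \<partial>\<pi> i))
        = (\<Sum>i\<in>I. lam i * (\<integral>y. G y \<bullet> m i y \<partial>\<rho>)) - (\<integral>y. G y \<bullet> w y \<partial>\<rho>)"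
      using lam(2) by (simp add: right_diff_distrib sum_subtractf flip: sum_distrib_right)
    also have "(\<Sum>i\<in>I. lam i * (\<integral>y. G y \<bullet> m i y \<partial>\<rho>)) = (\<integral>y. (\<Sum>i\<in>I. lam i * (G y \<bullet> m i y)) \<partial>\<rho>)"
      by (subst Bochner_Integration.integral_sum) (auto intro!: integrable_mult_right inner_int G bG m)
    also have "\<dots> = (\<integral>y. G y \<bullet> M y \<partial>\<rho>)"
      by (simp add: M_def inner_sum_right)
    also have "(\<integral>y. G y \<bullet> M y \<partial>\<rho>) - (\<integral>y. G y \<bullet> w y \<partial>\<rho>) = (\<integral>y. G y \<bullet> (M y - w y) \<partial>\<rho>)"
      using inner_int[OF G bG Mi] inner_int[OF G bG wi] by (simp add: inner_diff_right)
    finally show ?thesis .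
  qed
  define w where "w = (\<lambda>y. closest_point C (M y))"
  have wC: "w y \<in> C" for y unfolding w_def using C by (intro closest_point_in_set compact_imp_closed)
  have "continuous_on UNIV (closest_point C)"
    using C by (intro continuous_on_closest_point compact_imp_closed)
  hence [measurable]: "closest_point C \<in> borel_measurable borel" by (rule borel_measurable_continuous_onI)
  have wm [measurable]: "w \<in> borel_measurable borel" unfolding w_def by measurable
  have bw: "bounded (range w)" by (rule bounded_subset[OF compact_imp_bounded[OF C(1)]]) (auto intro: wC)
  \<comment> \<open>The average \<open>M\<close> is only known to be integrable, while \<open>key\<close> asks for a bounded test
    function; hence the truncation.\<close>
  have "AE y in \<rho>. norm (M y) \<le> real n \<longrightarrow> M y = w y" for n
  proof -
    define G where "G = (\<lambda>y. if norm (M y) \<le> real n then M y - w y else 0)"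
    have G [measurable]: "G \<in> borel_measurable borel" unfolding G_def by measurable
    have bG: "bounded (range G)"
    proof (rule boundedI)
      fix x assume "x \<in> range G"
      then obtain y where "x = G y" by blast
      thus "norm x \<le> real n + R"
        using norm_triangle_ineq4[of "M y" "w y"] R[OF wC, of y] order.trans[OF norm_ge_zero R[OF wC]] by (auto simp: G_def)
    qed
    have "(\<integral>y. G y \<bullet> (M y - w y) \<partial>\<rho>) \<le> 0"
      unfolding key[OF G bG wm bw, symmetric]
    proof (intro sum_nonpos mult_nonneg_nonpos lam(1))
      fix i assume i: "i \<in> I"
      have "AE z in \<pi> i. 0 \<le> - (G (snd z) \<bullet> (fst z - w (snd z)))"
        using supp[OF i]
      proof (rule eventually_mono)
        fix z :: "'a \<times> 'b" assume "fst z \<in> C"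
        hence "(M (snd z) - w (snd z)) \<bullet> (fst z - w (snd z)) \<le> 0"
          unfolding w_def using C by (intro closest_point_dot compact_imp_closed) auto
        thus "0 \<le> - (G (snd z) \<bullet> (fst z - w (snd z)))" by (auto simp: G_def)
      qed
      from integral_nonneg_AE[OF this]
      show "(\<integral>z. G (snd z) \<bullet> (fst z - w (snd z)) \<partial>\<pi> i) \<le> 0" by simp
    qed
    moreover have sq: "G y \<bullet> (M y - w y) = (norm (G y))\<^sup>2" for y
      by (auto simp: G_def power2_norm_eq_inner)
    ultimately have "(\<integral>y. (norm (G y))\<^sup>2 \<partial>\<rho>) \<le> 0" by simp
    moreover have "0 \<le> (\<integral>y. (norm (G y))\<^sup>2 \<partial>\<rho>)" by (intro integral_nonneg_AE) auto
    moreover have "integrable \<rho> (\<lambda>y. (norm (G y))\<^sup>2)"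
      unfolding power2_norm_eq_inner 
    proof (rule inner_int[OF G bG])
      obtain B where "\<And>y. norm (G y) \<le> B" using bG by (auto simp: bounded_iff)
      thus "integrable \<rho> G" by (intro \<rho>.integrable_const_bound[of _ B]) auto
    qed
    ultimately have "AE y in \<rho>. (norm (G y))\<^sup>2 = 0"
      by (subst integral_nonneg_eq_0_iff_AE[symmetric]) auto
    thus ?thesis by (rule eventually_mono) (auto simp: G_def split: if_splits)
  qed
  hence "AE y in \<rho>. \<forall>n :: nat. norm (M y) \<le> real n \<longrightarrow> M y = w y"
    unfolding AE_all_countable by blast
  hence ae: "AE y in \<rho>. M y = w y"
    by (rule eventually_mono) (use real_arch_simple in blast)
  show ?thesis
  proof (rule that[OF wm wC])
    fix G :: "'b \<Rightarrow> 'a" assume G: "G \<in> borel_measurable borel" "bounded (range G)"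
    have "(\<integral>y. G y \<bullet> (M y - w y) \<partial>\<rho>) = (\<integral>y. 0 \<partial>\<rho>)"
      using G(1) ae by (intro integral_cong_AE) (auto elim: eventually_mono)
    thus "(\<Sum>i\<in>I. lam i * (\<integral>z. G (snd z) \<bullet> (fst z - w (snd z)) \<partial>\<pi> i)) = 0"
      using key[OF G wm bw] by simp
  qed
qed

section \<open>The Bregman cost in the chart\<close>

context regular_bregman_generator
begin

text \<open>
  The divergence in the chart, on pairs of points of \<open>X\<close>. The indicators make it Borel measurable
  on the whole space.
\<close>

definition cost :: "(real ^ 'n) \<times> (real ^ 'n) \<Rightarrow> real" where
  "cost = (\<lambda>(x, z). indicator X x *\<^sub>R \<Omega> x - indicator X z *\<^sub>R \<Omega> z
     - (indicator X z *\<^sub>R grad \<Omega> z) \<bullet> (x - z))"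

lemma cost_eq: "x \<in> X \<Longrightarrow> z \<in> X \<Longrightarrow> cost (x, z) = \<Omega> x - \<Omega> z - grad \<Omega> z \<bullet> (x - z)"
  by (simp add: cost_def)

lemma cost_nonneg: "x \<in> X \<Longrightarrow> z \<in> X \<Longrightarrow> 0 \<le> cost (x, z)"
  using Omega_above_tangent[of x z] by (simp add: cost_eq)

lemma continuous_on_Omega: "continuous_on X \<Omega>"
  using Omega_derivative by (meson continuous_at_imp_continuous_on has_derivative_continuous)

lemma continuous_on_grad: "continuous_on X (grad \<Omega>)"
  unfolding grad_def using partial_derivative
  by (intro continuous_on_vec_lambda continuous_at_imp_continuous_on) (meson has_derivative_continuous)

lemma measurable_Omega [measurable]: "(\<lambda>x. indicator X x *\<^sub>R \<Omega> x) \<in> borel_measurable borel"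
  using open_X by (intro borel_measurable_continuous_on_indicator continuous_on_Omega) auto

lemma measurable_grad [measurable]: "(\<lambda>x. indicator X x *\<^sub>R grad \<Omega> x) \<in> borel_measurable borel"
  using open_X by (intro borel_measurable_continuous_on_indicator continuous_on_grad) auto

lemma measurable_cost [measurable]: "cost \<in> borel_measurable borel"
proof -
  have [measurable]: "fst \<in> borel_measurable (borel :: ((real ^ 'n) \<times> (real ^ 'n)) measure)"
     "snd \<in> borel_measurable (borel :: ((real ^ 'n) \<times> (real ^ 'n)) measure)"
    by (auto intro!: borel_measurable_continuous_onI continuous_intros)
  show ?thesis unfolding cost_def case_prod_beta
    by (intro borel_measurable_diff borel_measurable_inner
        measurable_compose[OF _ measurable_Omega] measurable_compose[OF _ measurable_grad]) measurable
qed

lemma continuous_on_cost: "C \<subseteq> X \<Longrightarrow> continuous_on (C \<times> C) cost"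
proof -
  assume C: "C \<subseteq> X"
  have f: "continuous_on (C \<times> C) (\<lambda>z. f (fst z))" "continuous_on (C \<times> C) (\<lambda>z. f (snd z))"
    if "continuous_on X f" for f :: "real ^ 'n \<Rightarrow> 'b :: topological_space"
    using C by (auto intro!: continuous_on_compose2[OF that] continuous_intros)
  have "continuous_on (C \<times> C)
      (\<lambda>z. \<Omega> (fst z) - \<Omega> (snd z) - grad \<Omega> (snd z) \<bullet> (fst z - snd z))"
    by (intro continuous_intros f continuous_on_Omega continuous_on_grad)
  thus ?thesis using C
    by (elim continuous_on_cong[THEN iffD1, rotated -1]) (auto simp: cost_eq subset_iff)
qed

text \<open>
  The generalized law of cosines for Bregman divergences.
\<close>

lemma cost_three_points:
  assumes "x \<in> X" "y \<in> X" "z \<in> X"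
  shows "cost (x, z) = cost (x, y) + cost (y, z) + (grad \<Omega> y - grad \<Omega> z) \<bullet> (x - y)"
  using assms by (simp add: cost_eq algebra_simps)

text \<open>
  In the decomposition of \<open>cost (x, z)\<close> through the point \<open>T z\<close>, the term \<open>cost (T z, z)\<close> is
  nonnegative and the remaining inner product pairs \<open>x - T z\<close> with a function of \<open>z\<close> alone, so that
  its weighted integral vanishes by the choice of \<open>T\<close>. As the gradient may be unbounded on \<open>X\<close>, the
  inequality is first proved on the sets \<open>A n\<close>, where everything is bounded, and then follows by
  monotone convergence.
\<close>

lemma cost_barycentric_projection:
  fixes \<pi> :: "'i \<Rightarrow> ((real ^ 'n) \<times> (real ^ 'n)) measure"
  assumes C: "compact C" "convex C" "C \<noteq> {}" "C \<subseteq> X"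
    and lam: "\<And>i. i \<in> I \<Longrightarrow> 0 \<le> lam i" "sum lam I = 1"
    and prob: "\<And>i. i \<in> I \<Longrightarrow> prob_space (\<pi> i)"
    and sets: "\<And>i. i \<in> I \<Longrightarrow> sets (\<pi> i) = sets borel"
    and supp: "\<And>i. i \<in> I \<Longrightarrow> AE z in \<pi> i. fst z \<in> C" "\<And>i. i \<in> I \<Longrightarrow> AE z in \<pi> i. snd z \<in> X"
    and snd: "\<And>i. i \<in> I \<Longrightarrow> distr (\<pi> i) borel snd = \<rho>"
  obtains T where "T \<in> borel_measurable borel" "\<And>y. T y \<in> C"
    "(\<Sum>i\<in>I. ennreal (lam i) * (\<integral>\<^sup>+ z. ennreal (cost (fst z, T (snd z))) \<partial>\<pi> i))
      \<le> (\<Sum>i\<in>I. ennreal (lam i) * (\<integral>\<^sup>+ z. ennreal (cost z) \<partial>\<pi> i))"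
proof -
  have fsm [measurable]: "fst \<in> borel_measurable (borel :: ((real ^ 'n) \<times> (real ^ 'n)) measure)"
     "snd \<in> borel_measurable (borel :: ((real ^ 'n) \<times> (real ^ 'n)) measure)"
    by (auto intro!: borel_measurable_continuous_onI continuous_intros)
  have mbl: "f \<in> measurable (\<pi> i) borel" if "i \<in> I" "f \<in> borel_measurable borel"
    for i and f :: "(real ^ 'n) \<times> (real ^ 'n) \<Rightarrow> 'c :: topological_space"
    using that sets by (simp cong: measurable_cong_sets)
  have fs_i: "fst \<in> borel_measurable (\<pi> i)" "snd \<in> borel_measurable (\<pi> i)" if "i \<in> I" for i
    using that by (auto intro: mbl fsm)
  obtain T where Tm [measurable]: "T \<in> borel_measurable borel" and TC: "\<And>y. T y \<in> C"
    and T0: "\<And>G. \<lbrakk>G \<in> borel_measurable borel; bounded (range G)\<rbrakk>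
       \<Longrightarrow> (\<Sum>i\<in>I. lam i * (\<integral>z. G (snd z) \<bullet> (fst z - T (snd z)) \<partial>\<pi> i)) = 0"
    using barycentric_projection[where \<pi>=\<pi> and I=I, OF C(1-3) lam prob fs_i supp(1) snd] by blast
  have TX: "T y \<in> X" for y using TC C(4) by blast
  define gX where "gX = (\<lambda>x. indicator X x *\<^sub>R grad \<Omega> x)"
  define oX where "oX = (\<lambda>x. indicator X x *\<^sub>R \<Omega> x)"
  have [measurable]: "gX \<in> borel_measurable borel" "oX \<in> borel_measurable borel"
    unfolding gX_def oX_def by measurable
  have bd: "bounded (grad \<Omega> ` C)" "bounded (\<Omega> ` C)" "bounded C"
    using C continuous_on_subset[OF continuous_on_grad C(4)] continuous_on_subset[OF continuous_on_Omega C(4)]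
    by (auto intro!: compact_imp_bounded compact_continuous_image)
  obtain b1 where b1: "\<forall>y\<in>grad \<Omega> ` C. norm y \<le> b1" using bd(1) unfolding bounded_iff by blast
  obtain b2 where b2: "\<forall>y\<in>\<Omega> ` C. norm y \<le> b2" using bd(2) unfolding bounded_iff by blast
  obtain b3 where b3: "\<forall>y\<in>C. norm y \<le> b3" using bd(3) unfolding bounded_iff by blast
  have b: "\<And>x. x \<in> C \<Longrightarrow> norm (grad \<Omega> x) \<le> b1"
     "\<And>x. x \<in> C \<Longrightarrow> \<bar>\<Omega> x\<bar> \<le> b2" "\<And>x. x \<in> C \<Longrightarrow> norm x \<le> b3"
    using b1 b2 b3 by auto
  define A where "A = (\<lambda>n. {y \<in> space borel. y \<in> X \<and> norm (gX y) \<le> real n \<and> \<bar>oX y\<bar> \<le> real n \<and> norm y \<le> real n})"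
  have [measurable]: "X \<in> sets borel" using open_X by auto
  have [measurable]: "A n \<in> sets borel" for n unfolding A_def by measurable
  have AX: "A n \<subseteq> X" for n by (auto simp: A_def)
  define L where "L = (\<lambda>n z. indicator (A n) (snd z) * cost (fst z, T (snd z)))"
  define U where "U = (\<lambda>n z. indicator (A n) (snd z) * cost z)"
  have [measurable]: "(\<lambda>z. cost (fst z, T (snd z))) \<in> borel_measurable borel"
    by (rule measurable_compose[OF _ measurable_cost]) (simp add: borel_prod[symmetric])
  have Lm [measurable]: "L n \<in> borel_measurable borel" and Um [measurable]: "U n \<in> borel_measurable borel" for n
    unfolding L_def U_def by measurable
  have step: "(\<Sum>i\<in>I. lam i * (\<integral>z. L n z \<partial>\<pi> i)) \<le> (\<Sum>i\<in>I. lam i * (\<integral>z. U n z \<partial>\<pi> i))"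
    and Li: "\<And>i. i \<in> I \<Longrightarrow> integrable (\<pi> i) (L n)"
    and Ui: "\<And>i. i \<in> I \<Longrightarrow> integrable (\<pi> i) (U n)" for n
  proof -
    define G where "G = (\<lambda>y. indicator (A n) y *\<^sub>R (gX (T y) - gX y))"
    have Gm [measurable]: "G \<in> borel_measurable borel" unfolding G_def by measurable
    have Gb: "norm (G y) \<le> b1 + real n" for y
      using norm_triangle_ineq4[of "gX (T y)" "gX y"] b(1)[OF TC[of y]] order.trans[OF norm_ge_zero b(1)[OF TC]] TX[of y]
      by (auto simp: G_def A_def gX_def indicator_def)
    have Gbd: "bounded (range G)" by (rule boundedI[of _ "b1 + real n"]) (auto simp: Gb)
    have int: "integrable (\<pi> i) (L n)" "integrable (\<pi> i) (U n)"
        "integrable (\<pi> i) (\<lambda>z. G (snd z) \<bullet> (fst z - T (snd z)))" if i: "i \<in> I" for i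
    proof -
      interpret prob_space "\<pi> i" by (rule prob[OF i])
      have cb: "norm (cost (x, y)) \<le> 2 * b2 + real n + (b1 + real n) * (2 * b3 + real n)"
        if x: "x \<in> C" and y: "y \<in> X" and y1: "norm (grad \<Omega> y) \<le> b1 + real n"
          and y2: "\<bar>\<Omega> y\<bar> \<le> b2 + real n" and y3: "norm y \<le> b3 + real n" for x y
      proof -
        have "\<bar>grad \<Omega> y \<bullet> (x - y)\<bar> \<le> norm (grad \<Omega> y) * norm (x - y)" by (rule Cauchy_Schwarz_ineq2)
        also have "\<dots> \<le> (b1 + real n) * (2 * b3 + real n)"
          using y1 y3 b(3)[OF x] norm_triangle_ineq4[of x y] order.trans[OF norm_ge_zero y1]
          by (intro mult_mono) auto
        finally show ?thesis using b(2)[OF x] y2 x y C(4) by (auto simp: cost_eq)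
      qed
      have b0: "0 \<le> b1" "0 \<le> b2" "0 \<le> b3"
        using order.trans[OF norm_ge_zero b(1)[OF TC]] order.trans[OF abs_ge_zero b(2)[OF TC]]
          order.trans[OF norm_ge_zero b(3)[OF TC]] by blast+
      let ?B = "2 * b2 + real n + (b1 + real n) * (2 * b3 + real n)"
      have B0: "0 \<le> ?B" using b0 by auto
      show "integrable (\<pi> i) (L n)"
      proof (rule integrable_const_bound)
        show "AE z in \<pi> i. norm (L n z) \<le> ?B"
          using supp(1)[OF i]
        proof (rule eventually_mono)
          fix z :: "(real ^ 'n) \<times> (real ^ 'n)" assume "fst z \<in> C"
          hence "norm (cost (fst z, T (snd z))) \<le> ?B"
            using b[OF TC[of "snd z"]] by (intro cb TX) auto
          thus "norm (L n z) \<le> ?B" using B0 by (simp add: L_def indicator_def)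
        qed
      qed (intro mbl i Lm)
      show "integrable (\<pi> i) (U n)"
      proof (rule integrable_const_bound)
        show "AE z in \<pi> i. norm (U n z) \<le> ?B"
          using supp(1)[OF i]
        proof (rule eventually_mono)
          fix z :: "(real ^ 'n) \<times> (real ^ 'n)" assume "fst z \<in> C"
          thus "norm (U n z) \<le> ?B"
            using cb[of "fst z" "snd z"] B0 b0
            by (cases "snd z \<in> A n") (auto simp: U_def A_def gX_def oX_def)
        qed
      qed (intro mbl i Um)
      show "integrable (\<pi> i) (\<lambda>z. G (snd z) \<bullet> (fst z - T (snd z)))"
      proof (rule integrable_const_bound)
        show "AE z in \<pi> i. norm (G (snd z) \<bullet> (fst z - T (snd z))) \<le> (b1 + real n) * (2 * b3)"
          using supp(1)[OF i]
        proof (rule eventually_mono)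
          fix z :: "(real ^ 'n) \<times> (real ^ 'n)" assume z: "fst z \<in> C"
          have "norm (G (snd z) \<bullet> (fst z - T (snd z))) \<le> norm (G (snd z)) * norm (fst z - T (snd z))"
            by (simp add: Cauchy_Schwarz_ineq2)
          also have "\<dots> \<le> (b1 + real n) * (2 * b3)"
            using b(3)[OF z] b(3)[OF TC[of "snd z"]] norm_triangle_ineq4[of "fst z" "T (snd z)"] b0
            by (intro mult_mono Gb) auto
          finally show "norm (G (snd z) \<bullet> (fst z - T (snd z))) \<le> (b1 + real n) * (2 * b3)" .
        qed
      qed (intro mbl i, measurable)
    qed
    show "integrable (\<pi> i) (L n)" "integrable (\<pi> i) (U n)" if "i \<in> I" for i using int that by auto
    have "(\<Sum>i\<in>I. lam i * (\<integral>z. L n z \<partial>\<pi> i))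
        = (\<Sum>i\<in>I. lam i * (\<integral>z. L n z + G (snd z) \<bullet> (fst z - T (snd z)) \<partial>\<pi> i))"
      using int T0[OF Gm Gbd] by (simp add: distrib_left sum.distrib)
    also have "\<dots> \<le> (\<Sum>i\<in>I. lam i * (\<integral>z. U n z \<partial>\<pi> i))"
    proof (intro sum_mono mult_left_mono lam(1))
      fix i assume i: "i \<in> I"
      show "(\<integral>z. L n z + G (snd z) \<bullet> (fst z - T (snd z)) \<partial>\<pi> i) \<le> (\<integral>z. U n z \<partial>\<pi> i)"
      proof (intro integral_mono_AE Bochner_Integration.integrable_add int i)
        show "AE z in \<pi> i. L n z + G (snd z) \<bullet> (fst z - T (snd z)) \<le> U n z"
          using supp(1)[OF i]
        proof (rule eventually_mono)
          fix z :: "(real ^ 'n) \<times> (real ^ 'n)" assume z: "fst z \<in> C"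
          show "L n z + G (snd z) \<bullet> (fst z - T (snd z)) \<le> U n z"
          proof (cases "snd z \<in> A n")
            case True
            hence sX: "snd z \<in> X" using AX by blast
            have fX: "fst z \<in> X" using z C(4) by blast
            show ?thesis
              using cost_three_points[OF fX TX sX, of "snd z"] cost_nonneg[OF TX sX, of "snd z"] True sX TX
              by (simp add: L_def U_def G_def gX_def)
          qed (simp add: L_def U_def G_def)
        qed
      qed
    qed
    finally show "(\<Sum>i\<in>I. lam i * (\<integral>z. L n z \<partial>\<pi> i)) \<le> (\<Sum>i\<in>I. lam i * (\<integral>z. U n z \<partial>\<pi> i))" .
  qed
  have L0: "AE z in \<pi> i. 0 \<le> L n z" and U0: "AE z in \<pi> i. 0 \<le> U n z"
    and UC: "AE z in \<pi> i. ennreal (U n z) \<le> ennreal (cost z)" if i: "i \<in> I" for i n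
  proof -
    have ae: "AE z in \<pi> i. fst z \<in> X \<and> snd z \<in> X"
      using supp(1)[OF i] supp(2)[OF i] C(4) by (auto elim: eventually_elim2)
    show "AE z in \<pi> i. 0 \<le> L n z"
      using ae by (rule eventually_mono) (auto simp: L_def intro!: mult_nonneg_nonneg cost_nonneg TX)
    show "AE z in \<pi> i. 0 \<le> U n z"
      using ae by (rule eventually_mono) (auto simp: U_def intro!: mult_nonneg_nonneg cost_nonneg)
    show "AE z in \<pi> i. ennreal (U n z) \<le> ennreal (cost z)"
      using ae by (rule eventually_mono) (auto simp: U_def indicator_def)
  qed
  have bound: "(\<Sum>i\<in>I. ennreal (lam i) * (\<integral>\<^sup>+ z. ennreal (L n z) \<partial>\<pi> i))
      \<le> (\<Sum>i\<in>I. ennreal (lam i) * (\<integral>\<^sup>+ z. ennreal (cost z) \<partial>\<pi> i))" for n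
  proof -
    have nn: "(\<Sum>i\<in>I. ennreal (lam i) * (\<integral>\<^sup>+ z. ennreal (V z) \<partial>\<pi> i)) = ennreal (\<Sum>i\<in>I. lam i * (\<integral>z. V z \<partial>\<pi> i))"
      if "\<And>i. i \<in> I \<Longrightarrow> integrable (\<pi> i) V" "\<And>i. i \<in> I \<Longrightarrow> AE z in \<pi> i. 0 \<le> V z" for V
    proof -
      have "(\<Sum>i\<in>I. ennreal (lam i) * (\<integral>\<^sup>+ z. ennreal (V z) \<partial>\<pi> i)) = (\<Sum>i\<in>I. ennreal (lam i * (\<integral>z. V z \<partial>\<pi> i)))"
        using that lam(1) by (intro sum.cong) (auto simp: nn_integral_eq_integral ennreal_mult integral_nonneg_AE)
      also have "\<dots> = ennreal (\<Sum>i\<in>I. lam i * (\<integral>z. V z \<partial>\<pi> i))"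
        using that lam(1) by (intro sum_ennreal mult_nonneg_nonneg integral_nonneg_AE)
      finally show ?thesis .
    qed
    have "(\<Sum>i\<in>I. ennreal (lam i) * (\<integral>\<^sup>+ z. ennreal (L n z) \<partial>\<pi> i))
        \<le> (\<Sum>i\<in>I. ennreal (lam i) * (\<integral>\<^sup>+ z. ennreal (U n z) \<partial>\<pi> i))"
    proof -
      have "(\<Sum>i\<in>I. ennreal (lam i) * (\<integral>\<^sup>+ z. ennreal (L n z) \<partial>\<pi> i)) = ennreal (\<Sum>i\<in>I. lam i * (\<integral>z. L n z \<partial>\<pi> i))"
        by (rule nn[OF Li L0])
      also have "\<dots> \<le> ennreal (\<Sum>i\<in>I. lam i * (\<integral>z. U n z \<partial>\<pi> i))" by (intro ennreal_leI step)
      also have "\<dots> = (\<Sum>i\<in>I. ennreal (lam i) * (\<integral>\<^sup>+ z. ennreal (U n z) \<partial>\<pi> i))"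
        by (rule nn[OF Ui U0, symmetric])
      finally show ?thesis .
    qed
    also have "\<dots> \<le> (\<Sum>i\<in>I. ennreal (lam i) * (\<integral>\<^sup>+ z. ennreal (cost z) \<partial>\<pi> i))"
      by (intro sum_mono mult_left_mono nn_integral_mono_AE UC) auto
    finally show ?thesis .
  qed
  have "(\<lambda>n. \<Sum>i\<in>I. ennreal (lam i) * (\<integral>\<^sup>+ z. ennreal (L n z) \<partial>\<pi> i)) \<longlonglongrightarrow>
      (\<Sum>i\<in>I. ennreal (lam i) * (\<integral>\<^sup>+ z. ennreal (cost (fst z, T (snd z))) \<partial>\<pi> i))"
  proof (intro tendsto_sum ennreal_tendsto_cmult)
    fix i assume i: "i \<in> I"
    have inc: "incseq (\<lambda>n z. ennreal (L n z))"
      by (intro incseq_SucI le_funI) (auto simp: L_def A_def indicator_def)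
    have "(\<lambda>n. ennreal (L n z)) \<longlonglongrightarrow> indicator X (snd z) * ennreal (cost (fst z, T (snd z)))" for z
    proof (cases "snd z \<in> X")
      case True
      obtain N where N: "max (norm (gX (snd z))) (max \<bar>oX (snd z)\<bar> (norm (snd z))) \<le> real N"
        using real_arch_simple by blast
      have "snd z \<in> A n" if "n \<ge> N" for n
      proof -
        have "real N \<le> real n" using that by simp
        thus ?thesis using N True by (auto simp: A_def)
      qed
      thus ?thesis using True
        by (intro tendsto_eventually) (auto simp: eventually_sequentially L_def intro!: exI[of _ N])
    next
      case False
      hence "snd z \<notin> A n" for n using AX by blast
      thus ?thesis using False by (simp add: L_def)
    qed
    from nn_integral_LIMSEQ[OF inc _ this]
    have "(\<lambda>n. \<integral>\<^sup>+ z. ennreal (L n z) \<partial>\<pi> i)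
        \<longlonglongrightarrow> (\<integral>\<^sup>+ z. indicator X (snd z) * ennreal (cost (fst z, T (snd z))) \<partial>\<pi> i)"
      using mbl[OF i measurable_compose[OF Lm measurable_ennreal]] by simp
    also have "(\<integral>\<^sup>+ z. indicator X (snd z) * ennreal (cost (fst z, T (snd z))) \<partial>\<pi> i)
        = (\<integral>\<^sup>+ z. ennreal (cost (fst z, T (snd z))) \<partial>\<pi> i)"
      using supp(2)[OF i] by (intro nn_integral_cong_AE) (auto elim: eventually_mono)
    finally show "(\<lambda>n. \<integral>\<^sup>+ z. ennreal (L n z) \<partial>\<pi> i)
        \<longlonglongrightarrow> (\<integral>\<^sup>+ z. ennreal (cost (fst z, T (snd z))) \<partial>\<pi> i)" .
  qed auto
  from LIMSEQ_le_const2[OF this] bound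
  have "(\<Sum>i\<in>I. ennreal (lam i) * (\<integral>\<^sup>+ z. ennreal (cost (fst z, T (snd z))) \<partial>\<pi> i))
      \<le> (\<Sum>i\<in>I. ennreal (lam i) * (\<integral>\<^sup>+ z. ennreal (cost z) \<partial>\<pi> i))" by blast
  thus ?thesis using that[OF Tm TC] by blast
qed

end

section \<open>Measures and couplings on the manifold and in the chart\<close>

context bregman_manifold
begin

lemma space_borel_of: "space (borel_of M) = topspace M"
  and sets_borel_of: "sets (borel_of M) = sigma_sets (topspace M) {U. openin M U}"
  unfolding borel_of_def by (auto simp: space_measure_of_conv sets_measure_of_conv dest: openin_subset)

lemma openin_in_sets: "openin M U \<Longrightarrow> U \<in> sets (borel_of M)"
  by (simp add: sets_borel_of)

lemma bij_chart: "bij_betw \<iota> (topspace M) X"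
  using homeomorphic_imp_injective_map[OF chart] homeomorphic_imp_surjective_map[OF chart]
  by (simp add: bij_betw_def)

lemma open_chart_image: "openin M U \<Longrightarrow> open (\<iota> ` U)"
  using chart openin_open_eq[OF open_X] by (metis homeomorphic_imp_open_map open_map_def)

lemma measurable_chart: "\<iota> \<in> measurable (borel_of M) borel"
proof (rule borel_measurableI)
  fix S :: "(real ^ 'n) set" assume S: "open S"
  have "openin M {p \<in> topspace M. \<iota> p \<in> X \<inter> S}"
    using homeomorphic_imp_continuous_map[OF chart] S by (intro openin_continuous_map_preimage) auto
  moreover have "{p \<in> topspace M. \<iota> p \<in> X \<inter> S} = \<iota> -` S \<inter> space (borel_of M)"
    using chart_in_X by (auto simp: space_borel_of)
  ultimately show "\<iota> -` S \<inter> space (borel_of M) \<in> sets (borel_of M)"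
    using openin_in_sets by simp
qed

text \<open>
  The inverse chart has to be extended to the whole Euclidean space, by a constant outside \<open>X\<close>,
  since measures in the chart are Borel measures on that space.
\<close>

lemma chart_inverse:
  assumes "topspace M \<noteq> {}"
  obtains \<kappa> where "\<kappa> \<in> measurable borel (borel_of M)"
    "\<And>x. x \<in> X \<Longrightarrow> \<iota> (\<kappa> x) = x" "\<And>p. p \<in> topspace M \<Longrightarrow> \<kappa> (\<iota> p) = p"
proof -
  obtain p0 where p0: "p0 \<in> topspace M" using assms by blast
  define \<kappa> where "\<kappa> = (\<lambda>x. if x \<in> X then inv_into (topspace M) \<iota> x else p0)"
  have \<kappa>1: "\<kappa> x \<in> topspace M" for x
    using bij_chart p0 by (auto simp: \<kappa>_def bij_betw_def inv_into_into)
  have \<kappa>2: "\<iota> (\<kappa> x) = x" if "x \<in> X" for x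
    using bij_chart that by (auto simp: \<kappa>_def bij_betw_def f_inv_into_f)
  have \<kappa>3: "\<kappa> (\<iota> p) = p" if "p \<in> topspace M" for p
    using bij_chart that chart_in_X by (auto simp: \<kappa>_def bij_betw_def inv_into_f_f)
  have "\<kappa> \<in> measurable borel (borel_of M)"
    unfolding borel_of_def
  proof (rule measurable_measure_of)
    fix U assume "U \<in> {U. openin M U}"
    hence U: "openin M U" by simp
    have "\<kappa> -` U \<inter> space borel = \<iota> ` U \<union> (if p0 \<in> U then - X else {})"
    proof (intro set_eqI)
      fix x show "x \<in> \<kappa> -` U \<inter> space borel \<longleftrightarrow> x \<in> \<iota> ` U \<union> (if p0 \<in> U then - X else {})"
      proof (cases "x \<in> X")
        case True thus ?thesis using \<kappa>2[OF True] \<kappa>3 openin_subset[OF U] by force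
      next
        case False
        hence "x \<notin> \<iota> ` U" using openin_subset[OF U] chart_in_X by blast
        thus ?thesis using False by (simp add: \<kappa>_def)
      qed
    qed
    thus "\<kappa> -` U \<inter> space borel \<in> sets borel"
      using open_chart_image[OF U] open_X by auto
  qed (auto dest: openin_subset simp: \<kappa>1)
  thus ?thesis using that \<kappa>2 \<kappa>3 by blast
qed

lemma cost_chart:
  "p \<in> topspace M \<Longrightarrow> q \<in> topspace M \<Longrightarrow> cost (\<iota> p, \<iota> q) = bregman_divergence X \<Omega> \<iota> p q"
  by (simp add: cost_eq chart_in_X bregman_divergence_eq)

text \<open>
  The complement of the support is a union of open null sets, and by the Lindelof property of
  Euclidean space countably many of them suffice.
\<close>

lemma AE_in_measure_support:
  assumes "\<mu> \<in> borel_prob M"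
  shows "AE p in \<mu>. p \<in> measure_support M \<mu>"
proof -
  have s: "sets \<mu> = sets (borel_of M)" using assms by (simp add: borel_prob_def)
  have sp: "space \<mu> = topspace M" using sets_eq_imp_space_eq[OF s] by (simp add: space_borel_of)
  define \<U> where "\<U> = {U. openin M U \<and> emeasure \<mu> U = 0}"
  obtain \<V> where \<V>: "\<V> \<subseteq> (`) \<iota> ` \<U>" "countable \<V>" "\<Union>\<V> = \<Union>((`) \<iota> ` \<U>)"
    using Lindelof_openin[of "(`) \<iota> ` \<U>" UNIV] open_chart_image by (auto simp: \<U>_def)
  then obtain \<W> where \<W>: "\<W> \<subseteq> \<U>" "countable \<W>" "\<V> = (`) \<iota> ` \<W>"
    using countable_subset_image[of \<V> "(`) \<iota>" \<U>] by blast
  have null: "\<Union>\<W> \<in> null_sets \<mu>"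
  proof -
    have "(\<Union>U\<in>\<W>. U) \<in> null_sets \<mu>"
      using \<W>(1,2) openin_in_sets s by (intro null_sets_UN') (auto simp: \<U>_def null_sets_def)
    thus ?thesis by simp
  qed
  from AE_not_in[OF this] AE_space
  show ?thesis
  proof eventually_elim
    fix p assume nW: "p \<notin> \<Union>\<W>" and "p \<in> space \<mu>"
    hence p: "p \<in> topspace M" by (simp add: sp)
    have "emeasure \<mu> U > 0" if U: "openin M U" "p \<in> U" for U
    proof (rule ccontr)
      assume "\<not> emeasure \<mu> U > 0"
      hence "U \<in> \<U>" using U by (simp add: \<U>_def not_gr_zero)
      hence "\<iota> p \<in> \<Union>\<V>" using \<V>(3) U(2) by blast
      then obtain W p' where W: "W \<in> \<W>" "p' \<in> W" "\<iota> p = \<iota> p'" using \<W>(3) by auto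
      hence "p' \<in> topspace M" using \<W>(1) openin_subset by (auto simp: \<U>_def)
      hence "p = p'" using W(3) p bij_chart by (auto simp: bij_betw_def inj_on_def)
      thus False using W nW by blast
    qed
    thus "p \<in> measure_support M \<mu>" using p by (simp add: measure_support_def)
  qed
qed

lemma compact_chart_support:
  assumes "compactly_supported M \<mu>"
  shows "compact (\<iota> ` measure_support M \<mu>)" "\<iota> ` measure_support M \<mu> \<subseteq> X"
proof -
  have "compactin (top_of_set X) (\<iota> ` measure_support M \<mu>)"
    using assms homeomorphic_imp_continuous_map[OF chart]
    unfolding compactly_supported_def by (rule image_compactin)
  thus "compact (\<iota> ` measure_support M \<mu>)" "\<iota> ` measure_support M \<mu> \<subseteq> X"
    by (simp_all add: compactin_subtopology)
qed

lemma couplings_nonempty: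
  assumes "\<mu> \<in> borel_prob M" "\<rho> \<in> borel_prob M"
  shows "couplings M \<mu> \<rho> \<noteq> {}"
proof -
  interpret \<mu>: prob_space \<mu> using assms by (simp add: borel_prob_def)
  interpret \<rho>: prob_space \<rho> using assms by (simp add: borel_prob_def)
  interpret P: pair_prob_space \<mu> \<rho> ..
  have s: "sets \<mu> = sets (borel_of M)" "sets \<rho> = sets (borel_of M)" using assms by (simp_all add: borel_prob_def)
  have "distr (\<mu> \<Otimes>\<^sub>M \<rho>) (borel_of M) fst = distr (\<mu> \<Otimes>\<^sub>M \<rho>) \<mu> fst"
    by (rule distr_cong) (simp_all add: s)
  also have "\<dots> = \<mu>" by (rule \<rho>.distr_pair_fst)
  finally have 1: "distr (\<mu> \<Otimes>\<^sub>M \<rho>) (borel_of M) fst = \<mu>" .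
  have 2: "distr (\<mu> \<Otimes>\<^sub>M \<rho>) (borel_of M) snd = \<rho>"
  proof (rule measure_eqI)
    fix A assume "A \<in> sets (distr (\<mu> \<Otimes>\<^sub>M \<rho>) (borel_of M) snd)"
    hence A: "A \<in> sets \<rho>" by (simp add: s)
    have m: "snd \<in> measurable (\<mu> \<Otimes>\<^sub>M \<rho>) (borel_of M)" 
      using measurable_snd[of \<mu> \<rho>] s(2) by (simp cong: measurable_cong_sets)
    have "snd -` A \<inter> space (\<mu> \<Otimes>\<^sub>M \<rho>) = space \<mu> \<times> A"
      using sets.sets_into_space[OF A] by (auto simp: space_pair_measure)
    thus "emeasure (distr (\<mu> \<Otimes>\<^sub>M \<rho>) (borel_of M) snd) A = emeasure \<rho> A"
      using A s(2) by (simp add: emeasure_distr[OF m] \<rho>.emeasure_pair_measure_Times \<mu>.emeasure_space_1)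
  qed (simp add: s)
  have "\<mu> \<Otimes>\<^sub>M \<rho> \<in> couplings M \<mu> \<rho>"
    unfolding couplings_def using 1 2 P.prob_space_axioms s by (auto intro: sets_pair_measure_cong)
  thus ?thesis by blast
qed

lemma measurable_chart_pair:
  "map_prod \<iota> \<iota> \<in> measurable (borel_of M \<Otimes>\<^sub>M borel_of M) borel"
  unfolding map_prod_def case_prod_beta borel_prod[symmetric]
  using measurable_chart by (intro measurable_Pair) (auto intro: measurable_compose[OF measurable_fst] measurable_compose[OF measurable_snd])

lemma coupling_in_chart:
  assumes \<pi>: "\<pi> \<in> couplings M \<mu> \<rho>" and \<mu>: "\<mu> \<in> borel_prob M"
    and C: "C \<in> sets borel" "\<iota> ` measure_support M \<mu> \<subseteq> C"
  defines "\<pi>' \<equiv> distr \<pi> borel (map_prod \<iota> \<iota>)"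
  shows "prob_space \<pi>'" "sets \<pi>' = sets borel"
    "AE z in \<pi>'. snd z \<in> X" "AE z in \<pi>'. fst z \<in> C"
    "distr \<pi>' borel fst = distr \<mu> borel \<iota>" "distr \<pi>' borel snd = distr \<rho> borel \<iota>"
    "(\<integral>\<^sup>+ z. ennreal (cost z) \<partial>\<pi>')
      = (\<integral>\<^sup>+ z. ennreal (bregman_divergence X \<Omega> \<iota> (fst z) (snd z)) \<partial>\<pi>)"
proof -
  have prob: "prob_space \<pi>" and s: "sets \<pi> = sets (borel_of M \<Otimes>\<^sub>M borel_of M)"
    and marg: "distr \<pi> (borel_of M) fst = \<mu>" "distr \<pi> (borel_of M) snd = \<rho>"
    using \<pi> by (auto simp: couplings_def)
  have sp: "space \<pi> = topspace M \<times> topspace M"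
    using sets_eq_imp_space_eq[OF s] by (simp add: space_pair_measure space_borel_of)
  have m: "map_prod \<iota> \<iota> \<in> measurable \<pi> borel" "fst \<in> measurable \<pi> (borel_of M)" "snd \<in> measurable \<pi> (borel_of M)"
    using measurable_chart_pair s by (simp_all cong: measurable_cong_sets)
  have fsm: "fst \<in> borel_measurable (borel :: ((real ^ 'n) \<times> (real ^ 'n)) measure)"
     "snd \<in> borel_measurable (borel :: ((real ^ 'n) \<times> (real ^ 'n)) measure)"
    by (auto intro!: borel_measurable_continuous_onI continuous_intros)
  show "prob_space \<pi>'" unfolding \<pi>'_def by (rule prob_space.prob_space_distr[OF prob m(1)])
  show "sets \<pi>' = sets borel" by (simp add: \<pi>'_def)
  show "distr \<pi>' borel fst = distr \<mu> borel \<iota>"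
    unfolding \<pi>'_def marg(1)[symmetric] distr_distr[OF fsm(1) m(1)] distr_distr[OF measurable_chart m(2)]
    by (rule distr_cong) auto
  show "distr \<pi>' borel snd = distr \<rho> borel \<iota>"
    unfolding \<pi>'_def marg(2)[symmetric] distr_distr[OF fsm(2) m(1)] distr_distr[OF measurable_chart m(3)]
    by (rule distr_cong) auto
  have "(\<integral>\<^sup>+ z. ennreal (cost z) \<partial>\<pi>') = (\<integral>\<^sup>+ z. ennreal (cost (map_prod \<iota> \<iota> z)) \<partial>\<pi>)"
    unfolding \<pi>'_def by (rule nn_integral_distr[OF m(1)]) simp
  also have "\<dots> = (\<integral>\<^sup>+ z. ennreal (bregman_divergence X \<Omega> \<iota> (fst z) (snd z)) \<partial>\<pi>)"
    by (rule nn_integral_cong) (auto simp: sp cost_chart)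
  finally show "(\<integral>\<^sup>+ z. ennreal (cost z) \<partial>\<pi>')
      = (\<integral>\<^sup>+ z. ennreal (bregman_divergence X \<Omega> \<iota> (fst z) (snd z)) \<partial>\<pi>)" .
  have m': "fst -` A \<in> sets (borel :: ((real ^ 'n) \<times> (real ^ 'n)) measure)"
    "snd -` A \<in> sets (borel :: ((real ^ 'n) \<times> (real ^ 'n)) measure)" if "A \<in> sets borel" for A
    using measurable_sets[OF fsm(1) that] measurable_sets[OF fsm(2) that] by simp_all
  show "AE z in \<pi>'. snd z \<in> X"
    unfolding \<pi>'_def using m'(2)[of X] open_X
    by (subst AE_distr_iff[OF m(1)]) (auto simp: vimage_def sp chart_in_X intro!: AE_I2)
  have "AE z in \<pi>. fst z \<in> measure_support M \<mu>"
    using AE_distrD[OF m(2), of "\<lambda>p. p \<in> measure_support M \<mu>"] AE_in_measure_support[OF \<mu>]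
    unfolding marg(1) by blast
  hence "AE z in \<pi>. fst (map_prod \<iota> \<iota> z) \<in> C"
    by (rule eventually_mono) (use C in auto)
  thus "AE z in \<pi>'. fst z \<in> C"
    unfolding \<pi>'_def using m'(1)[of C] C(1)
    by (subst AE_distr_iff[OF m(1)]) (auto simp: vimage_def)
qed

lemma coupling_from_chart:
  assumes \<kappa>: "\<kappa> \<in> measurable borel (borel_of M)" "\<And>x. x \<in> X \<Longrightarrow> \<iota> (\<kappa> x) = x"
      "\<And>p. p \<in> topspace M \<Longrightarrow> \<kappa> (\<iota> p) = p"
    and \<mu>: "\<mu> \<in> borel_prob M"
    and \<pi>': "prob_space \<pi>'" "sets \<pi>' = sets borel" "AE z in \<pi>'. z \<in> X \<times> X"
      "distr \<pi>' borel fst = distr \<mu> borel \<iota>" "distr \<pi>' borel snd = \<rho>'"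
  defines "\<pi> \<equiv> distr \<pi>' (borel_of M \<Otimes>\<^sub>M borel_of M) (map_prod \<kappa> \<kappa>)"
  shows "\<pi> \<in> couplings M \<mu> (distr \<rho>' (borel_of M) \<kappa>)"
    "(\<integral>\<^sup>+ z. ennreal (bregman_divergence X \<Omega> \<iota> (fst z) (snd z)) \<partial>\<pi>) \<le> (\<integral>\<^sup>+ z. ennreal (cost z) \<partial>\<pi>')"
proof -
  have s\<mu>: "sets \<mu> = sets (borel_of M)" using \<mu> by (simp add: borel_prob_def)
  have fsm: "fst \<in> borel_measurable (borel :: ((real ^ 'n) \<times> (real ^ 'n)) measure)"
     "snd \<in> borel_measurable (borel :: ((real ^ 'n) \<times> (real ^ 'n)) measure)"
    by (auto intro!: borel_measurable_continuous_onI continuous_intros)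
  have fs: "fst \<in> measurable \<pi>' borel" "snd \<in> measurable \<pi>' borel"
    using fsm \<pi>'(2) by (simp_all cong: measurable_cong_sets)
  have m: "map_prod \<kappa> \<kappa> \<in> measurable \<pi>' (borel_of M \<Otimes>\<^sub>M borel_of M)"
    unfolding map_prod_def case_prod_beta
    by (intro measurable_Pair measurable_compose[OF _ \<kappa>(1)] fs)
  have "distr \<pi> (borel_of M) fst = distr (distr \<pi>' borel fst) (borel_of M) \<kappa>"
    unfolding \<pi>_def distr_distr[OF measurable_fst m] distr_distr[OF \<kappa>(1) fs(1)] by (rule distr_cong) auto
  also have "\<dots> = distr \<mu> (borel_of M) (\<kappa> \<circ> \<iota>)"
    unfolding \<pi>'(4) using measurable_chart s\<mu> by (intro distr_distr \<kappa>(1)) (simp cong: measurable_cong_sets)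
  also have "\<dots> = distr \<mu> \<mu> (\<lambda>p. p)"
    using sets_eq_imp_space_eq[OF s\<mu>] \<kappa>(3) by (intro distr_cong) (auto simp: s\<mu> space_borel_of)
  finally have 1: "distr \<pi> (borel_of M) fst = \<mu>" by (simp add: distr_id2)
  have 2: "distr \<pi> (borel_of M) snd = distr \<rho>' (borel_of M) \<kappa>"
    unfolding \<pi>_def distr_distr[OF measurable_snd m] \<pi>'(5)[symmetric] distr_distr[OF \<kappa>(1) fs(2)]
    by (rule distr_cong) auto
  show "\<pi> \<in> couplings M \<mu> (distr \<rho>' (borel_of M) \<kappa>)"
    unfolding couplings_def using 1 2 prob_space.prob_space_distr[OF \<pi>'(1) m] by (simp add: \<pi>_def)
  have "(\<integral>\<^sup>+ z. ennreal (bregman_divergence X \<Omega> \<iota> (fst z) (snd z)) \<partial>\<pi>)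
      = (\<integral>\<^sup>+ z. ennreal (cost (map_prod \<iota> \<iota> z)) \<partial>\<pi>)"
    unfolding \<pi>_def by (rule nn_integral_cong) (auto simp: space_pair_measure space_borel_of cost_chart)
  also have "\<dots> = (\<integral>\<^sup>+ z. ennreal (cost (map_prod \<iota> \<iota> (map_prod \<kappa> \<kappa> z))) \<partial>\<pi>')"
    unfolding \<pi>_def
    by (rule nn_integral_distr[OF m], unfold measurable_distr_eq1)
      (rule measurable_compose[OF measurable_compose[OF measurable_chart_pair measurable_cost] measurable_ennreal])
  also have "\<dots> = (\<integral>\<^sup>+ z. ennreal (cost z) \<partial>\<pi>')"
    using \<pi>'(3) by (intro nn_integral_cong_AE) (auto simp: \<kappa>(2) elim!: eventually_mono)
  finally show "(\<integral>\<^sup>+ z. ennreal (bregman_divergence X \<Omega> \<iota> (fst z) (snd z)) \<partial>\<pi>) \<le> (\<integral>\<^sup>+ z. ennreal (cost z) \<partial>\<pi>')"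
    by simp
qed

end

section \<open>Existence of the barycenter\<close>

context bregman_manifold
begin

text \<open>
  Minimizing sequences of couplings can be chosen for each \<open>\<nu> i\<close> separately, so the weighted sum of
  the infima is the infimum of the weighted sums, also when some of them are infinite.
\<close>

lemma le_sum_bregman_wassersteinI:
  assumes \<nu>: "\<And>i. i \<in> I \<Longrightarrow> \<nu> i \<in> borel_prob M" and \<rho>: "\<rho> \<in> borel_prob M"
    and low: "\<And>\<pi>. (\<And>i. i \<in> I \<Longrightarrow> \<pi> i \<in> couplings M (\<nu> i) \<rho>) \<Longrightarrow>
      m \<le> (\<Sum>i\<in>I. ennreal (lam i) * (\<integral>\<^sup>+ z. ennreal (bregman_divergence X \<Omega> \<iota> (fst z) (snd z)) \<partial>\<pi> i))"
  shows "m \<le> (\<Sum>i\<in>I. ennreal (lam i) * bregman_wasserstein X \<Omega> M \<iota> (\<nu> i) \<rho>)"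
proof -
  define J where "J = (\<lambda>\<pi>. \<integral>\<^sup>+ z. ennreal (bregman_divergence X \<Omega> \<iota> (fst z) (snd z)) \<partial>\<pi>)"
  have "\<forall>i\<in>I. \<exists>\<pi>. (\<forall>n. \<pi> n \<in> couplings M (\<nu> i) \<rho>)
      \<and> (\<lambda>n. J (\<pi> n)) \<longlonglongrightarrow> bregman_wasserstein X \<Omega> M \<iota> (\<nu> i) \<rho>"
  proof
    fix i assume i: "i \<in> I"
    obtain u where u: "\<And>n. u n \<in> J ` couplings M (\<nu> i) \<rho>"
        "u \<longlonglongrightarrow> Inf (J ` couplings M (\<nu> i) \<rho>)"
      using Inf_as_limit[of "J ` couplings M (\<nu> i) \<rho>"] couplings_nonempty[OF \<nu>[OF i] \<rho>] by blast
    from u(1) have "\<forall>n. \<exists>\<pi>. \<pi> \<in> couplings M (\<nu> i) \<rho> \<and> u n = J \<pi>" by blast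
    from choice[OF this] obtain \<pi> where "\<And>n. \<pi> n \<in> couplings M (\<nu> i) \<rho>" "\<And>n. u n = J (\<pi> n)" by blast
    thus "\<exists>\<pi>. (\<forall>n. \<pi> n \<in> couplings M (\<nu> i) \<rho>)
      \<and> (\<lambda>n. J (\<pi> n)) \<longlonglongrightarrow> bregman_wasserstein X \<Omega> M \<iota> (\<nu> i) \<rho>"
      using u(2) unfolding bregman_wasserstein_def J_def[symmetric] by (intro exI[of _ \<pi>]) (simp flip: \<open>\<And>n. u n = J (\<pi> n)\<close>)
  qed
  from bchoice[OF this] obtain \<pi> where \<pi>: "\<And>i n. i \<in> I \<Longrightarrow> \<pi> i n \<in> couplings M (\<nu> i) \<rho>"
    "\<And>i. i \<in> I \<Longrightarrow> (\<lambda>n. J (\<pi> i n)) \<longlonglongrightarrow> bregman_wasserstein X \<Omega> M \<iota> (\<nu> i) \<rho>" by blast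
  have "(\<lambda>n. \<Sum>i\<in>I. ennreal (lam i) * J (\<pi> i n))
      \<longlonglongrightarrow> (\<Sum>i\<in>I. ennreal (lam i) * bregman_wasserstein X \<Omega> M \<iota> (\<nu> i) \<rho>)"
    by (intro tendsto_sum ennreal_tendsto_cmult \<pi>) auto
  moreover have "m \<le> (\<Sum>i\<in>I. ennreal (lam i) * J (\<pi> i n))" for n
    unfolding J_def by (intro low \<pi>)
  ultimately show ?thesis by (intro LIMSEQ_le_const) auto
qed

lemma right_barycenter_exists:
  assumes I: "finite I" "\<And>i. i \<in> I \<Longrightarrow> 0 \<le> lam i" "sum lam I = 1"
    and \<nu>: "\<And>i. i \<in> I \<Longrightarrow> \<nu> i \<in> borel_prob M" "\<And>i. i \<in> I \<Longrightarrow> compactly_supported M (\<nu> i)"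
  obtains \<nu>bar where "\<nu>bar \<in> borel_prob M"
    "\<And>\<rho>. \<rho> \<in> borel_prob M \<Longrightarrow>
      (\<Sum>i\<in>I. ennreal (lam i) * bregman_wasserstein X \<Omega> M \<iota> (\<nu> i) \<nu>bar)
      \<le> (\<Sum>i\<in>I. ennreal (lam i) * bregman_wasserstein X \<Omega> M \<iota> (\<nu> i) \<rho>)"
proof -
  define J where "J = (\<lambda>\<pi>. \<integral>\<^sup>+ z. ennreal (bregman_divergence X \<Omega> \<iota> (fst z) (snd z)) \<partial>\<pi>)"
  \<comment> \<open>The infimum is taken jointly over the measure and over its couplings with all \<open>\<nu> i\<close>.\<close>
  define V where "V = {\<Sum>i\<in>I. ennreal (lam i) * J (\<pi> i) | \<rho> \<pi>.
    \<rho> \<in> borel_prob M \<and> (\<forall>i\<in>I. \<pi> i \<in> couplings M (\<nu> i) \<rho>)}"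
  have "I \<noteq> {}" using I(3) by auto
  then obtain j where j: "j \<in> I" by blast
  have fsm: "fst \<in> borel_measurable (borel :: ((real ^ 'n) \<times> (real ^ 'n)) measure)"
     "snd \<in> borel_measurable (borel :: ((real ^ 'n) \<times> (real ^ 'n)) measure)"
    by (auto intro!: borel_measurable_continuous_onI continuous_intros)
  define C where "C = convex hull (\<Union>i\<in>I. \<iota> ` measure_support M (\<nu> i))"
  have C: "compact C" "convex C" "C \<subseteq> X"
  proof -
    show "compact C" unfolding C_def using I(1) compact_chart_support[OF \<nu>(2)]
      by (intro compact_convex_hull compact_UN)
    show "convex C" unfolding C_def by (rule convex_convex_hull)
    show "C \<subseteq> X" unfolding C_def using compact_chart_support[OF \<nu>(2)] convex_X
      by (intro hull_minimal UN_least)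
  qed
  have SC: "\<iota> ` measure_support M (\<nu> i) \<subseteq> C" if "i \<in> I" for i
    unfolding C_def using that by (intro order.trans[OF _ hull_subset]) auto
  have pr: "prob_space (\<nu> j)" using \<nu>(1)[OF j] by (simp add: borel_prob_def)
  have mne: "measure_support M (\<nu> j) \<noteq> {}"
  proof
    assume "measure_support M (\<nu> j) = {}"
    hence "AE p in \<nu> j. False" using AE_in_measure_support[OF \<nu>(1)[OF j]] by simp
    thus False using prob_space.AE_False[OF pr] by simp
  qed
  have "measure_support M (\<nu> j) \<subseteq> topspace M" by (auto simp: measure_support_def)
  hence ne: "C \<noteq> {}" "topspace M \<noteq> {}" using mne SC[OF j] by blast+
  obtain \<kappa> where \<kappa>: "\<kappa> \<in> measurable borel (borel_of M)"
    "\<And>x. x \<in> X \<Longrightarrow> \<iota> (\<kappa> x) = x" "\<And>p. p \<in> topspace M \<Longrightarrow> \<kappa> (\<iota> p) = p"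
    using chart_inverse[OF ne(2)] by blast
  have "V \<noteq> {}"
  proof -
    have "\<forall>i\<in>I. \<exists>\<pi>. \<pi> \<in> couplings M (\<nu> i) (\<nu> j)" using couplings_nonempty \<nu>(1) j by blast
    from bchoice[OF this] show ?thesis using \<nu>(1)[OF j] unfolding V_def by blast
  qed
  then obtain v where v: "\<And>n. v n \<in> V" "v \<longlonglongrightarrow> Inf V" using Inf_as_limit[of V] by blast
  \<comment> \<open>Each competitor in a minimizing sequence is replaced by its barycentric projection, which does
    not increase the value and moves all couplings into the compact set \<open>C \<times> C\<close>.\<close>
  define good where "good = (\<lambda>n \<pi> \<rho>'. (\<forall>i\<in>I. prob_space (\<pi> i) \<and> sets (\<pi> i) = sets borel
      \<and> (AE z in \<pi> i. z \<in> C \<times> C) \<and> distr (\<pi> i) borel fst = distr (\<nu> i) borel \<iota>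
      \<and> distr (\<pi> i) borel snd = \<rho>')
      \<and> (\<Sum>i\<in>I. ennreal (lam i) * (\<integral>\<^sup>+ z. ennreal (cost z) \<partial>\<pi> i)) \<le> v n)"
  have "\<forall>n. \<exists>\<pi>. \<exists>\<rho>'. good n \<pi> \<rho>'"
  proof
    fix n
    obtain \<rho> \<pi> where \<rho>: "\<rho> \<in> borel_prob M" and \<pi>: "\<And>i. i \<in> I \<Longrightarrow> \<pi> i \<in> couplings M (\<nu> i) \<rho>"
      and vn: "v n = (\<Sum>i\<in>I. ennreal (lam i) * J (\<pi> i))"
      using v(1)[of n] unfolding V_def by blast
    define \<pi>1 where "\<pi>1 = (\<lambda>i. distr (\<pi> i) borel (map_prod \<iota> \<iota>))"
    have Cb: "C \<in> sets borel" using C(1) by (simp add: borel_compact)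
    have ch: "prob_space (\<pi>1 i)" "sets (\<pi>1 i) = sets borel"
        "AE z in \<pi>1 i. snd z \<in> X" "AE z in \<pi>1 i. fst z \<in> C"
        "distr (\<pi>1 i) borel fst = distr (\<nu> i) borel \<iota>" "distr (\<pi>1 i) borel snd = distr \<rho> borel \<iota>"
        "(\<integral>\<^sup>+ z. ennreal (cost z) \<partial>\<pi>1 i) = J (\<pi> i)" if i: "i \<in> I" for i
      unfolding \<pi>1_def J_def by (rule coupling_in_chart[OF \<pi>[OF i] \<nu>(1)[OF i] Cb SC[OF i]])+
    obtain T where Tm: "T \<in> borel_measurable borel" and TC: "\<And>y. T y \<in> C"
      and le: "(\<Sum>i\<in>I. ennreal (lam i) * (\<integral>\<^sup>+ z. ennreal (cost (fst z, T (snd z))) \<partial>\<pi>1 i))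
        \<le> (\<Sum>i\<in>I. ennreal (lam i) * (\<integral>\<^sup>+ z. ennreal (cost z) \<partial>\<pi>1 i))"
      using cost_barycentric_projection[where \<pi>=\<pi>1 and I=I, OF C(1,2) ne(1) C(3) I(2,3) ch(1,2,4,3,6)]
      by blast
    define \<pi>2 where "\<pi>2 = (\<lambda>i. distr (\<pi>1 i) borel (\<lambda>z. (fst z, T (snd z))))"
    have Pm: "(\<lambda>z. (fst z, T (snd z))) \<in> borel_measurable (borel :: ((real ^ 'n) \<times> (real ^ 'n)) measure)"
      using measurable_Pair[OF fsm(1) measurable_compose[OF fsm(2) Tm]] by (simp add: borel_prod)
    have "good n \<pi>2 (distr (distr \<rho> borel \<iota>) borel T)"
      unfolding good_def
    proof (intro conjI ballI)
      fix i assume i: "i \<in> I"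
      have mb: "f \<in> measurable (\<pi>1 i) N" if "f \<in> measurable borel N" for f and N :: "'z measure"
        using that ch(2)[OF i] by (simp cong: measurable_cong_sets)
      show "prob_space (\<pi>2 i)"
        unfolding \<pi>2_def by (intro prob_space.prob_space_distr ch(1) mb Pm i)
      show "sets (\<pi>2 i) = sets borel" by (simp add: \<pi>2_def)
      show "AE z in \<pi>2 i. z \<in> C \<times> C"
        unfolding \<pi>2_def using C(1) ch(4)[OF i] TC
        by (subst AE_distr_iff[OF mb[OF Pm]]) (auto simp: borel_compact compact_Times)
      show "distr (\<pi>2 i) borel fst = distr (\<nu> i) borel \<iota>"
        unfolding \<pi>2_def distr_distr[OF fsm(1) mb[OF Pm]] ch(5)[OF i, symmetric]
        by (rule distr_cong) auto
      show "distr (\<pi>2 i) borel snd = distr (distr \<rho> borel \<iota>) borel T"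
        unfolding \<pi>2_def distr_distr[OF fsm(2) mb[OF Pm]] ch(6)[OF i, symmetric] distr_distr[OF Tm mb[OF fsm(2)]]
        by (rule distr_cong) auto
    next
      have "(\<Sum>i\<in>I. ennreal (lam i) * (\<integral>\<^sup>+ z. ennreal (cost z) \<partial>\<pi>2 i))
          = (\<Sum>i\<in>I. ennreal (lam i) * (\<integral>\<^sup>+ z. ennreal (cost (fst z, T (snd z))) \<partial>\<pi>1 i))"
      proof (rule sum.cong[OF refl])
        fix i assume i: "i \<in> I"
        have "(\<lambda>z. (fst z, T (snd z))) \<in> measurable (\<pi>1 i) borel"
          using Pm ch(2)[OF i] by (simp cong: measurable_cong_sets)
        thus "ennreal (lam i) * (\<integral>\<^sup>+ z. ennreal (cost z) \<partial>\<pi>2 i)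
            = ennreal (lam i) * (\<integral>\<^sup>+ z. ennreal (cost (fst z, T (snd z))) \<partial>\<pi>1 i)"
          unfolding \<pi>2_def by (subst nn_integral_distr) auto
      qed
      also have "\<dots> \<le> v n" using le ch(7) by (simp add: vn)
      finally show "(\<Sum>i\<in>I. ennreal (lam i) * (\<integral>\<^sup>+ z. ennreal (cost z) \<partial>\<pi>2 i)) \<le> v n" .
    qed
    thus "\<exists>\<pi>. \<exists>\<rho>'. good n \<pi> \<rho>'" by blast
  qed
  from choice[OF this] obtain \<pi> where "\<forall>n. \<exists>\<rho>'. good n (\<pi> n) \<rho>'" by blast
  from choice[OF this] obtain \<rho> where good: "\<And>n. good n (\<pi> n) (\<rho> n)" by blast
  have g: "prob_space (\<pi> n i)" "sets (\<pi> n i) = sets borel" "AE z in \<pi> n i. z \<in> C \<times> C"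
    "distr (\<pi> n i) borel fst = distr (\<nu> i) borel \<iota>" "distr (\<pi> n i) borel snd = \<rho> n" if "i \<in> I" for n i
    using good[of n] that by (auto simp: good_def)
  have gv: "(\<Sum>i\<in>I. ennreal (lam i) * (\<integral>\<^sup>+ z. ennreal (cost z) \<partial>\<pi> n i)) \<le> v n" for n
    using good[of n] by (auto simp: good_def)
  have cn: "0 \<le> cost z" if "z \<in> C \<times> C" for z
    using that C(3) by (cases z) (auto intro: cost_nonneg)
  obtain r \<pi>' \<rho>' where r: "strict_mono r"
    and lim: "\<And>i. i \<in> I \<Longrightarrow> prob_space (\<pi>' i)" "\<And>i. i \<in> I \<Longrightarrow> sets (\<pi>' i) = sets borel"
    "\<And>i. i \<in> I \<Longrightarrow> AE z in \<pi>' i. z \<in> C \<times> C"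
    "\<And>i. i \<in> I \<Longrightarrow> distr (\<pi>' i) borel fst = distr (\<nu> i) borel \<iota>"
    "\<And>i. i \<in> I \<Longrightarrow> distr (\<pi>' i) borel snd = \<rho>'"
    "\<And>i. i \<in> I \<Longrightarrow> (\<lambda>n. \<integral>\<^sup>+ z. ennreal (cost z) \<partial>\<pi> (r n) i) \<longlonglongrightarrow> (\<integral>\<^sup>+ z. ennreal (cost z) \<partial>\<pi>' i)"
    using couplings_compact_subsequence[where \<pi>=\<pi> and I=I and \<rho>=\<rho>,
      OF I(1) C(1) g continuous_on_cost[OF C(3)] cn] by blast
  define \<nu>bar where "\<nu>bar = distr \<rho>' (borel_of M) \<kappa>"
  define \<pi>bar where "\<pi>bar = (\<lambda>i. distr (\<pi>' i) (borel_of M \<Otimes>\<^sub>M borel_of M) (map_prod \<kappa> \<kappa>))"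
  have limX: "AE z in \<pi>' i. z \<in> X \<times> X" if "i \<in> I" for i
    using lim(3)[OF that] C(3) by (auto elim!: eventually_mono)
  have bar: "\<pi>bar i \<in> couplings M (\<nu> i) \<nu>bar" "J (\<pi>bar i) \<le> (\<integral>\<^sup>+ z. ennreal (cost z) \<partial>\<pi>' i)"
    if i: "i \<in> I" for i
    unfolding \<pi>bar_def \<nu>bar_def J_def
    using coupling_from_chart[OF \<kappa> \<nu>(1)[OF i] lim(1,2)[OF i] limX[OF i] lim(4,5)[OF i]] by auto
  have "\<nu>bar \<in> borel_prob M"
  proof -
    have "prob_space \<rho>'" unfolding lim(5)[OF j, symmetric]
      using lim(1,2)[OF j] fsm by (intro prob_space.prob_space_distr) (auto cong: measurable_cong_sets)
    moreover have "\<kappa> \<in> measurable \<rho>' (borel_of M)"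
      using \<kappa>(1) unfolding lim(5)[OF j, symmetric] by simp
    ultimately show ?thesis unfolding \<nu>bar_def borel_prob_def by (auto intro: prob_space.prob_space_distr)
  qed
  moreover have "(\<Sum>i\<in>I. ennreal (lam i) * bregman_wasserstein X \<Omega> M \<iota> (\<nu> i) \<nu>bar)
      \<le> (\<Sum>i\<in>I. ennreal (lam i) * bregman_wasserstein X \<Omega> M \<iota> (\<nu> i) \<rho>)" if \<rho>: "\<rho> \<in> borel_prob M" for \<rho>
  proof -
    have "(\<Sum>i\<in>I. ennreal (lam i) * bregman_wasserstein X \<Omega> M \<iota> (\<nu> i) \<nu>bar)
        \<le> (\<Sum>i\<in>I. ennreal (lam i) * (\<integral>\<^sup>+ z. ennreal (cost z) \<partial>\<pi>' i))"
      unfolding bregman_wasserstein_def J_def[symmetric]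
    proof (intro sum_mono mult_left_mono)
      fix i assume i: "i \<in> I"
      show "(INF \<pi>\<in>couplings M (\<nu> i) \<nu>bar. J \<pi>) \<le> (\<integral>\<^sup>+ z. ennreal (cost z) \<partial>\<pi>' i)"
        using INF_lower[OF bar(1)[OF i], of J] bar(2)[OF i] by (rule order.trans)
    qed simp
    also have "\<dots> \<le> Inf V"
    proof (rule LIMSEQ_le)
      show "(\<lambda>n. \<Sum>i\<in>I. ennreal (lam i) * (\<integral>\<^sup>+ z. ennreal (cost z) \<partial>\<pi> (r n) i))
          \<longlonglongrightarrow> (\<Sum>i\<in>I. ennreal (lam i) * (\<integral>\<^sup>+ z. ennreal (cost z) \<partial>\<pi>' i))"
        by (intro tendsto_sum ennreal_tendsto_cmult lim(6)) auto
      show "(\<lambda>n. v (r n)) \<longlonglongrightarrow> Inf V" using LIMSEQ_subseq_LIMSEQ[OF v(2) r] by (simp add: o_def)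
    qed (use gv in auto)
    also have "\<dots> \<le> (\<Sum>i\<in>I. ennreal (lam i) * bregman_wasserstein X \<Omega> M \<iota> (\<nu> i) \<rho>)"
    proof (rule le_sum_bregman_wassersteinI[OF \<nu>(1) \<rho>])
      fix \<pi> assume "\<And>i. i \<in> I \<Longrightarrow> \<pi> i \<in> couplings M (\<nu> i) \<rho>"
      hence "Inf V \<le> (\<Sum>i\<in>I. ennreal (lam i) * J (\<pi> i))"
        using \<rho> by (intro Inf_lower) (auto simp: V_def)
      thus "Inf V \<le> (\<Sum>i\<in>I. ennreal (lam i) * (\<integral>\<^sup>+ z. ennreal (bregman_divergence X \<Omega> \<iota> (fst z) (snd z)) \<partial>\<pi> i))"
        by (simp add: J_def)
    qed
    finally show ?thesis .
  qed
  ultimately show ?thesis using that by blast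
qed

end

theorem theorem5p2:
  fixes X :: "(real ^ 'n) set" and \<Omega> :: "real ^ 'n \<Rightarrow> real"
    and M :: "'m topology" and \<iota> :: "'m \<Rightarrow> real ^ 'n"
    and K :: nat and \<nu> :: "nat \<Rightarrow> 'm measure" and lam :: "nat \<Rightarrow> real"
  assumes "bregman_manifold X \<Omega> M \<iota>"
    and "\<And>i. i \<in> {1..K} \<Longrightarrow> \<nu> i \<in> borel_prob M"
    and "\<And>i. i \<in> {1..K} \<Longrightarrow> compactly_supported M (\<nu> i)"
    and "\<And>i. i \<in> {1..K} \<Longrightarrow> absolutely_continuous (riemannian_volume X \<Omega> M \<iota>) (\<nu> i)"
    and "\<And>i. i \<in> {1..K} \<Longrightarrow> lam i \<ge> 0"
    and "(\<Sum>i=1..K. lam i) = 1"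
  shows "\<exists>\<nu>bar. right_barycenter X \<Omega> M \<iota> K lam \<nu> \<nu>bar"
proof -
  interpret bregman_manifold X \<Omega> M \<iota> by (rule assms(1))
  obtain \<nu>bar where "\<nu>bar \<in> borel_prob M"
    "\<And>\<rho>. \<rho> \<in> borel_prob M \<Longrightarrow>
      (\<Sum>i=1..K. ennreal (lam i) * bregman_wasserstein X \<Omega> M \<iota> (\<nu> i) \<nu>bar)
      \<le> (\<Sum>i=1..K. ennreal (lam i) * bregman_wasserstein X \<Omega> M \<iota> (\<nu> i) \<rho>)"
    using right_barycenter_exists[of "{1..K}" lam \<nu>] assms(2,3,5,6) by blast
  thus ?thesis
    unfolding right_barycenter_def is_arg_min_def by (auto simp: not_less)
qed

end
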